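(* Assume $f$ is convex, let $\gamma^*$ be a solution of the problem $\min\{f(\gamma):\gamma\in\overline\Gamma^*,\ \langle\mathbf a_i,\gamma\rangle\le b_i\ \forall i\}$, and suppose there is a non-negative vector $\lambda\in\mathbb R^N$ such that $f(\gamma)+\langle\lambda,\mathbf A\gamma-\mathbf b\rangle\ge f(\gamma^* )$ for all $\gamma\in\overline\Gamma^*$. Let $T>1$ be an integer, run the algorithm described in the context with $V=\sqrt T$ and $\eta=1/\sqrt T$, and let $\overline x_T:=\frac1T\sum_{t=0}^{T-1}x_t$. Then $$\mathbb E[f(\overline x_T)]\le f(\gamma^* )+\Big(2K+MD+\frac{B^2}{2}+\frac{LD^2}{2}\Big)\frac1{T^{1/2}},$$ $$\langle\mathbf a_i,\mathbb E[\overline x_T]\rangle-b_i\le\frac{2\|\lambda\|}{\sqrt T}+\sqrt{\frac{2\|\mathbf A^T\lambda\|D+4K+B^2+LD^2}{T}},\qquad\forall i\in\{1,\dots,N\},$$ and the objective bound also holds with $f(\mathbb E[\overline x_T])$ in place of $\mathbb E[f(\overline x_T)]$. Thus the convergence time to $\varepsilon$-near optimality is $\mathcal O(1/\varepsilon^2)$: there is a constant $C$ depending only on $K,M,D,B,L,\|\lambda\|,\|\mathbf A^T\lambda\|$ such that for every $\varepsilon\in(0,1]$ and every integer $T>1$ with $T\ge C/\varepsilon^2$, the point $\mathbb E[\overline x_T]$ is an $\varepsilon$-near optimal solution.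
   Context: Setting. Let $m,d,N\ge1$ be integers, $\langle\cdot,\cdot\rangle$ the dot product, $\|\cdot\|$ the Euclidean norm; vector inequalities are entrywise. $\mathcal B\subseteq\mathbb R^d$ is compact and convex. $\{S[t]\}_{t\ge0}$ is an i.i.d. sequence of random vectors with values in a set $\mathcal S\subseteq\mathbb R^m$. For each $s\in\mathcal S$, $\mathcal X_s\subseteq\mathcal B$ is a (nonempty) compact set, the decision options when the state is $s$. At each slot $t\in\{0,1,2,\dots\}$ the controller observes $S[t]$ and chooses $x_t\in\mathcal X_{S[t]}$. The history $\mathcal H_t$ consists of $S[0],\dots,S[t-1],x_0,\dots,x_{t-1}$. A randomized stationary algorithm chooses $x_t\in\mathcal X_{S[t]}$ as a stationary randomized function of $S[t]$ (the same conditional distribution given the same value of $S[t]$), independently of $\mathcal H_t$. $\Gamma^*\subseteq\mathbb R^d$ is the set of all expectations $\mathbb E[x_t]$ achievable at a slot by randomized stationary algorithms, and $\overline\Gamma^*$ is its closure; $\overline\Gamma^*$ is a convex subset of $\mathcal B$. Assume $0\in\overline\Gamma^*$. Given $\mathbf a_1,\dots,\mathbf a_N\in\mathbb R^d$ and $b_1,\dots,b_N\in\mathbb R$, put $\mathbf A=[\mathbf a_1,\dots,\mathbf a_N]^T$, $\mathbf b=[b_1,\dots,b_N]^T$. The problem is to minimize $f(\gamma)$ subject to $\gamma\in\overline\Gamma^*$ and $\mathbf A\gamma\le\mathbf b$, assumed feasible. Assumptions on $f$. $f:\mathcal B\to\mathbb R$ is differentiable with $\|\nabla f(x)-\nabla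 f(y)\|\le L\|x-y\|$ for all $x,y\in\mathcal B$, and there are constants with $\sup_{\gamma\in\mathcal B}\|\nabla f(\gamma)\|\le M$, $\sup_{\gamma\in\mathcal B}|f(\gamma)|\le K$, $\sup_{\gamma\in\mathcal B}\sum_{i=1}^N|\langle\mathbf a_i,\gamma\rangle-b_i|^2\le B^2$, and $\|x-y\|\le D$ for all $x,y\in\mathcal B$. Algorithm (parameters $V>0$, $0<\eta<1$). Set $\gamma_{-1}=0$ and $Q_i(0)=0$ for all $i$; $\mathbf Q(t)=[Q_1(t),\dots,Q_N(t)]$. At each slot $t=0,1,2,\dots$: (1) observe $S[t]$ and choose $x_t\in\mathcal X_{S[t]}$ minimizing $V\langle\nabla f(\gamma_{t-1}),x\rangle+\sum_{i=1}^NQ_i(t)\langle\mathbf a_i,x\rangle$ over $x\in\mathcal X_{S[t]}$ ($x_t$ is determined, measurably, by $\gamma_{t-1},\mathbf Q(t),S[t]$); (2) set $\gamma_t=(1-\eta)\gamma_{t-1}+\eta x_t$ and $Q_i(t+1)=\max\{Q_i(t)+\langle\mathbf a_i,x_t\rangle-b_i,0\}$ for all $i$. Definition. With $\gamma^*$ a solution of the problem, a point $\gamma\in\overline\Gamma^*$ is $\varepsilon$-near optimal if $f(\gamma)\le f(\gamma^* )+\varepsilon$ and $\langle\mathbf a_i,\gamma\rangle-b_i\le\varepsilon$ for all $i$. *)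

theory Defs
  imports "HOL-Probability.Probability"
begin

text \<open>
  A randomized stationary algorithm is a Markov kernel \<open>\<kappa>\<close> on the state set, with \<open>\<kappa> s\<close> the
  conditional law of the decision given the state \<open>s\<close>; it is concentrated on \<open>X s\<close>.  The law of
  its decision in a slot with random state \<open>S0\<close> is then the mixture of \<open>\<kappa>\<close> under the law of \<open>S0\<close>.
  The state set need not be Borel, so it carries the trace of the Borel sets.
\<close>

definition stationary_kernel ::
  "(real^'m) set \<Rightarrow> (real^'m \<Rightarrow> (real^'d) set) \<Rightarrow> (real^'m \<Rightarrow> (real^'d) measure) \<Rightarrow> bool" where
  "stationary_kernel SS X \<kappa> \<longleftrightarrow>
     \<kappa> \<in> restrict_space borel SS \<rightarrow>\<^sub>M prob_algebra borel \<and>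
     (\<forall>s\<in>SS. AE x in \<kappa> s. x \<in> X s)"

definition stationary_expectations ::
  "'w measure \<Rightarrow> ('w \<Rightarrow> real^'m) \<Rightarrow> (real^'m) set \<Rightarrow> (real^'m \<Rightarrow> (real^'d) set) \<Rightarrow> (real^'d) set" where
  "stationary_expectations P S0 SS X =
     {(\<integral>x. x \<partial>(distr P (restrict_space borel SS) S0 \<bind> \<kappa>)) | \<kappa>. stationary_kernel SS X \<kappa>}"

text \<open>All \<open>S t\<close> have the same law, so using slot 0 is immaterial.\<close>

definition closed_region ::
  "'w measure \<Rightarrow> (nat \<Rightarrow> 'w \<Rightarrow> real^'m) \<Rightarrow> (real^'m) set \<Rightarrow> (real^'m \<Rightarrow> (real^'d) set) \<Rightarrow> (real^'d) set" where
  "closed_region P S SS X = closure (stationary_expectations P (S 0) SS X)"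

definition iid_states :: "'w measure \<Rightarrow> (nat \<Rightarrow> 'w \<Rightarrow> real^'m) \<Rightarrow> (real^'m) set \<Rightarrow> bool" where
  "iid_states P S SS \<longleftrightarrow>
     prob_space.indep_vars P (\<lambda>_. borel) S UNIV \<and>
     (\<forall>t. distr P borel (S t) = distr P borel (S 0)) \<and>
     (\<forall>t. \<forall>\<omega>\<in>space P. S t \<omega> \<in> SS)"

text \<open>The row \<open>A $ i\<close> is the constraint vector \<open>a_i\<close>; \<open>\<le>\<close> on vectors is entrywise.\<close>

definition is_solution ::
  "(real^'d \<Rightarrow> real) \<Rightarrow> (real^'d) set \<Rightarrow> real^'d^'n \<Rightarrow> real^'n \<Rightarrow> real^'d \<Rightarrow> bool" where
  "is_solution f G A b \<gamma>s \<longleftrightarrow> is_arg_min f (\<lambda>\<gamma>. \<gamma> \<in> G \<and> A *v \<gamma> \<le> b) \<gamma>s"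

definition near_optimal ::
  "(real^'d \<Rightarrow> real) \<Rightarrow> (real^'d) set \<Rightarrow> real^'d^'n \<Rightarrow> real^'n \<Rightarrow> real^'d \<Rightarrow> real \<Rightarrow> real^'d \<Rightarrow> bool" where
  "near_optimal f G A b \<gamma>s \<epsilon> \<gamma> \<longleftrightarrow>
     \<gamma> \<in> G \<and> f \<gamma> \<le> f \<gamma>s + \<epsilon> \<and> (\<forall>i. A $ i \<bullet> \<gamma> - b $ i \<le> \<epsilon>)"

text \<open>
  \<open>choice g q s\<close> is the decision taken when \<open>\<gamma>_{t-1} = g\<close>, \<open>Q(t) = q\<close> and \<open>S[t] = s\<close>.
  The auxiliary points stay in \<open>BB\<close> and the queues stay non-negative, so nothing is required
  of \<open>choice\<close> elsewhere.
\<close>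

definition decision_rule ::
  "(real^'m) set \<Rightarrow> (real^'m \<Rightarrow> (real^'d) set) \<Rightarrow> (real^'d) set \<Rightarrow> (real^'d \<Rightarrow> real^'d) \<Rightarrow> real^'d^'n
   \<Rightarrow> real \<Rightarrow> (real^'d \<Rightarrow> real^'n \<Rightarrow> real^'m \<Rightarrow> real^'d) \<Rightarrow> bool" where
  "decision_rule SS X BB gradf A V choice \<longleftrightarrow>
     (\<lambda>(g, q, s). choice g q s) \<in> borel_measurable (restrict_space borel (BB \<times> {0..} \<times> SS)) \<and>
     (\<forall>g\<in>BB. \<forall>q\<ge>0. \<forall>s\<in>SS.
        is_arg_min (\<lambda>x. V * (gradf g \<bullet> x) + (\<Sum>i\<in>UNIV. q $ i * (A $ i \<bullet> x)))
          (\<lambda>x. x \<in> X s) (choice g q s))"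

text \<open>
  The sequence of auxiliary points is shifted by one: \<open>\<gamma> t\<close> stands for \<open>\<gamma>_{t-1}\<close>, so that
  \<open>\<gamma> 0\<close> is the initial point \<open>\<gamma>_{-1}\<close>.  Ties may be broken differently in different slots.
\<close>

definition algorithm_run ::
  "'w measure \<Rightarrow> (nat \<Rightarrow> 'w \<Rightarrow> real^'m) \<Rightarrow> (real^'m) set \<Rightarrow> (real^'m \<Rightarrow> (real^'d) set) \<Rightarrow> (real^'d) set
   \<Rightarrow> (real^'d \<Rightarrow> real^'d) \<Rightarrow> real^'d^'n \<Rightarrow> real^'n \<Rightarrow> real \<Rightarrow> real
   \<Rightarrow> (nat \<Rightarrow> 'w \<Rightarrow> real^'d) \<Rightarrow> (nat \<Rightarrow> 'w \<Rightarrow> real^'d) \<Rightarrow> (nat \<Rightarrow> 'w \<Rightarrow> real^'n) \<Rightarrow> bool" where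
  "algorithm_run P S SS X BB gradf A b V \<eta> x \<gamma> Q \<longleftrightarrow>
     (\<exists>choice. (\<forall>t. decision_rule SS X BB gradf A V (choice t)) \<and>
        (\<forall>\<omega>\<in>space P. \<gamma> 0 \<omega> = 0 \<and> Q 0 \<omega> = 0 \<and>
           (\<forall>t. x t \<omega> = choice t (\<gamma> t \<omega>) (Q t \<omega>) (S t \<omega>) \<and>
                \<gamma> (Suc t) \<omega> = (1 - \<eta>) *\<^sub>R \<gamma> t \<omega> + \<eta> *\<^sub>R x t \<omega> \<and>
                (\<forall>i. Q (Suc t) \<omega> $ i = max (Q t \<omega> $ i + A $ i \<bullet> x t \<omega> - b $ i) 0))))"

definition time_avg :: "(nat \<Rightarrow> 'w \<Rightarrow> real^'d) \<Rightarrow> nat \<Rightarrow> 'w \<Rightarrow> real^'d" where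
  "time_avg x T \<omega> = (1 / real T) *\<^sub>R (\<Sum>t<T. x t \<omega>)"

text \<open>
  The constant of the convergence time, as a function of the problem constants and of
  \<open>l = norm \<lambda>\<close>, \<open>al = norm (A^T \<lambda>)\<close>: the square of the larger of the two coefficients of
  \<open>1 / sqrt T\<close> in the error bounds.  It is a closed term because a constant quantified
  existentially inside a theorem could still depend on the types, i.e. on the dimensions and
  on the sample space.
\<close>

definition convergence_const ::
  "real \<Rightarrow> real \<Rightarrow> real \<Rightarrow> real \<Rightarrow> real \<Rightarrow> real \<Rightarrow> real \<Rightarrow> real" where
  "convergence_const K M D B L l al =
     (max (2 * K + M * D + B\<^sup>2 / 2 + L * D\<^sup>2 / 2)
          (2 * l + sqrt (2 * al * D + 4 * K + B\<^sup>2 + L * D\<^sup>2)))\<^sup>2"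

end

theory Submission
  imports Defs
begin

text \<open>
  The proof is a drift-plus-penalty argument.  Along a run, combine the quadratic Lyapunov
  function \<open>\<parallel>Q(t)\<parallel>\<^sup>2 / 2\<close> of the queues with the scaled objective \<open>(V / \<eta>) f(\<gamma>_t)\<close>.  Its one-slot
  increase is at most a constant plus
  \<open>V \<nabla>f(\<gamma>_{t-1}) \<bullet> (x_t - \<gamma>_{t-1}) + Q(t) \<bullet> (A x_t - b)\<close>,
  because \<open>f\<close> is smooth (\<open>smooth_upper_bound\<close>) and taking positive parts does not increase
  norms.  The decision \<open>x_t\<close> minimizes exactly the part of this expression that depends on it, for
  every value of the state.  As \<open>S[t]\<close> is independent of \<open>(\<gamma>_{t-1}, Q(t))\<close>, which is a function of
  the earlier states, \<open>x_t\<close> does at least as well in expectation as any point of the closed region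
  of stationary expectations (\<open>expected_cost_le\<close>).  Comparing with an optimal point, where convexity
  of \<open>f\<close> controls the gradient term and feasibility makes the queue term nonpositive, gives
  \<open>expected_step\<close>; summation over the slots gives \<open>accumulated_drift\<close>, from which both bounds follow.

  For the objective, drop the queue term.  This bounds the average of \<open>E f(\<gamma>_{t-1})\<close>; since
  \<open>x_t - \<gamma>_{t-1} = (\<gamma>_t - \<gamma>_{t-1}) / \<eta>\<close> telescopes, the time averages of \<open>x_t\<close> and \<open>\<gamma>_{t-1}\<close> differ
  by at most \<open>D / (\<eta> T)\<close>, so the bound carries over to \<open>x\<close> at the cost of \<open>M D / (\<eta> T)\<close>.

  For the constraints, the drift inequality bounds \<open>E \<parallel>Q(T)\<parallel>\<^sup>2\<close> by the accumulated amounts by which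
  \<open>E f(\<gamma>_{t-1})\<close> can fall below the optimal value.  The multiplier \<open>\<lambda>\<close> bounds these amounts by
  the constraint violations of \<open>E \<gamma>_{t-1}\<close>, hence again by \<open>\<parallel>\<lambda>\<parallel> E \<parallel>Q(T)\<parallel>\<close> up to the telescoping error.
  The resulting quadratic inequality for \<open>E \<parallel>Q(T)\<parallel>\<close> (\<open>expected_queue_bound\<close>) is solved by
  \<open>quadratic_bound_root\<close>, and the violation of the averaged decision is at most
  \<open>E \<parallel>Q(T)\<parallel> / T\<close>.

  The multiplier inequality and near-optimality refer to points of the closed region, so
  \<open>E x_t\<close>, \<open>E \<gamma>_t\<close> and \<open>E\<close> of the time average have to be placed in it.
  The decision \<open>x_t\<close> is that of a stationary algorithm that draws its own independent copy of
  \<open>(\<gamma>_{t-1}, Q(t))\<close> as a random seed (\<open>seeded_kernel\<close>, \<open>expectation_x_in_region\<close>); the other two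
  are convex combinations of such points and, for \<open>\<gamma>_t\<close>, of \<open>0\<close> (\<open>convex_region\<close>).
\<close>

section \<open>Smooth convex functions on a convex set\<close>

text \<open>
  Along the segment from \<open>y\<close> to \<open>z\<close>, subtract from \<open>f\<close> the claimed quadratic majorant; by the
  Lipschitz bound on the gradient the difference has nonpositive derivative.  The derivatives are
  taken within \<open>C\<close>, so that the segment may run along the boundary of \<open>C\<close>.
\<close>

lemma smooth_upper_bound:
  fixes f :: "'a::real_inner \<Rightarrow> real"
  assumes C: "convex C"
    and deriv: "\<And>y. y \<in> C \<Longrightarrow> (f has_derivative (\<lambda>h. g y \<bullet> h)) (at y within C)"
    and lip: "L-lipschitz_on C g"
    and y: "y \<in> C" and z: "z \<in> C"
  shows "f z \<le> f y + g y \<bullet> (z - y) + L / 2 * (norm (z - y))\<^sup>2"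
proof -
  define d where "d = z - y"
  define \<phi> where "\<phi> u = f (y + u *\<^sub>R d) - u * (g y \<bullet> d) - L / 2 * u\<^sup>2 * (norm d)\<^sup>2" for u
  have seg: "y + u *\<^sub>R d \<in> C" if "0 \<le> u" "u \<le> 1" for u
  proof -
    have "y + u *\<^sub>R d = (1 - u) *\<^sub>R y + u *\<^sub>R z" by (simp add: d_def algebra_simps)
    then show ?thesis using C y z that by (simp add: convexD_alt)
  qed
  have "\<exists>u\<in>{0..1}. \<phi> 1 - \<phi> 0 = (\<lambda>h. h * (g (y + u *\<^sub>R d) \<bullet> d - g y \<bullet> d - L * u * (norm d)\<^sup>2)) (1 - 0)"
  proof (rule mvt_very_simple)
    fix u :: real assume u: "0 \<le> u" "u \<le> 1"
    have "((\<lambda>u. f (y + u *\<^sub>R d)) has_derivative (\<lambda>h. g (y + u *\<^sub>R d) \<bullet> (h *\<^sub>R d))) (at u within {0..1})"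
    proof (rule has_derivative_in_compose[where f="\<lambda>u. y + u *\<^sub>R d" and g=f and f'="\<lambda>h. h *\<^sub>R d" and g'="\<lambda>h. g (y + u *\<^sub>R d) \<bullet> h"])
      show "((\<lambda>u. y + u *\<^sub>R d) has_derivative (\<lambda>h. h *\<^sub>R d)) (at u within {0..1})"
        by (auto intro!: derivative_eq_intros)
      show "(f has_derivative (\<lambda>h. g (y + u *\<^sub>R d) \<bullet> h)) (at (y + u *\<^sub>R d) within (\<lambda>u. y + u *\<^sub>R d) ` {0..1})"
        using deriv[OF seg[OF u]] by (rule has_derivative_subset) (auto intro: seg)
    qed
    then show "(\<phi> has_derivative (\<lambda>h. h * (g (y + u *\<^sub>R d) \<bullet> d - g y \<bullet> d - L * u * (norm d)\<^sup>2))) (at u within {0..1})"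
      unfolding \<phi>_def by (auto intro!: derivative_eq_intros simp: fun_eq_iff algebra_simps)
  qed simp
  then obtain u where u: "0 \<le> u" "u \<le> 1"
    and eq: "\<phi> 1 - \<phi> 0 = g (y + u *\<^sub>R d) \<bullet> d - g y \<bullet> d - L * u * (norm d)\<^sup>2" by auto
  have "g (y + u *\<^sub>R d) \<bullet> d - g y \<bullet> d = (g (y + u *\<^sub>R d) - g y) \<bullet> d" by (simp add: inner_diff_left)
  also have "\<dots> \<le> norm (g (y + u *\<^sub>R d) - g y) * norm d" by (rule norm_cauchy_schwarz)
  also have "\<dots> \<le> (L * norm (u *\<^sub>R d)) * norm d"
    using lipschitz_onD[OF lip seg[OF u] y] by (intro mult_right_mono) (auto simp: dist_norm)
  also have "\<dots> = L * u * (norm d)\<^sup>2" using u by (simp add: power2_eq_square)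
  finally have "\<phi> 1 - \<phi> 0 \<le> 0" using eq by simp
  then show ?thesis by (simp add: \<phi>_def d_def)
qed

lemma smooth_lower_bound:
  fixes f :: "'a::real_inner \<Rightarrow> real"
  assumes C: "convex C"
    and deriv: "\<And>y. y \<in> C \<Longrightarrow> (f has_derivative (\<lambda>h. g y \<bullet> h)) (at y within C)"
    and lip: "L-lipschitz_on C g"
    and y: "y \<in> C" and z: "z \<in> C"
  shows "f z \<ge> f y + g y \<bullet> (z - y) - L / 2 * (norm (z - y))\<^sup>2"
proof -
  have "- f z \<le> - f y + (- g y) \<bullet> (z - y) + L / 2 * (norm (z - y))\<^sup>2"
  proof (rule smooth_upper_bound[OF C _ _ y z])
    show "((\<lambda>x. - f x) has_derivative (\<lambda>h. (- g w) \<bullet> h)) (at w within C)" if "w \<in> C" for w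
      using has_derivative_minus[OF deriv[OF that]] by simp
    show "L-lipschitz_on C (\<lambda>x. - g x)" using lip by simp
  qed
  then show ?thesis by simp
qed

text \<open>
  Compare \<open>f\<close> at \<open>y + u (z - y)\<close> with the chord from above and with the quadratic minorant from
  below.  After division by \<open>u\<close> the two differ from the claim by a term linear in \<open>u\<close>, which
  vanishes as \<open>u\<close> tends to \<open>0\<close>.
\<close>

lemma convex_tangent_bound:
  fixes f :: "'a::real_inner \<Rightarrow> real"
  assumes C: "convex C"
    and deriv: "\<And>y. y \<in> C \<Longrightarrow> (f has_derivative (\<lambda>h. g y \<bullet> h)) (at y within C)"
    and lip: "L-lipschitz_on C g"
    and f: "convex_on C f"
    and y: "y \<in> C" and z: "z \<in> C"
  shows "f z \<ge> f y + g y \<bullet> (z - y)"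
proof -
  define q where "q = L / 2 * (norm (z - y))\<^sup>2"
  have key: "f z - f y - g y \<bullet> (z - y) \<ge> - q * u" if u: "0 < u" "u \<le> 1" for u
  proof -
    let ?w = "(1 - u) *\<^sub>R y + u *\<^sub>R z"
    have w: "?w \<in> C" and d: "?w - y = u *\<^sub>R (z - y)"
      using convexD_alt[OF C y z, of u] u by (auto simp: algebra_simps)
    have "f y + u * (g y \<bullet> (z - y)) - L / 2 * (u * norm (z - y))\<^sup>2 \<le> f ?w"
      using smooth_lower_bound[OF C deriv lip y w] u unfolding d by simp
    also have "\<dots> \<le> (1 - u) * f y + u * f z" using convex_onD[OF f, of u y z] y z u by simp
    finally have "0 \<le> u * (f z - f y - g y \<bullet> (z - y) + q * u)"
      by (simp add: q_def power_mult_distrib power2_eq_square algebra_simps)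
    then show ?thesis using u by (simp add: zero_le_mult_iff)
  qed
  have "(\<lambda>u. - q * u) \<midarrow>0\<rightarrow> - q * 0" by (intro tendsto_intros)
  then have "((\<lambda>u. - q * u) \<longlongrightarrow> 0) (at_right 0)" by (simp add: filterlim_at_split)
  moreover have "\<forall>\<^sub>F u in at_right 0. - q * u \<le> f z - f y - g y \<bullet> (z - y)"
    unfolding eventually_at_right_field using key by (intro exI[of _ 1]) auto
  ultimately have "0 \<le> f z - f y - g y \<bullet> (z - y)"
    by (intro tendsto_upperbound[of _ 0 "at_right 0"]) auto
  then show ?thesis by simp
qed

section \<open>Averages, positive parts and a quadratic inequality\<close>

definition positive_part :: "real^'n \<Rightarrow> real^'n" where
  "positive_part w = (\<chi> i. max (w $ i) 0)"

lemma continuous_positive_part: "continuous_on UNIV positive_part"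
  unfolding positive_part_def by (intro continuous_intros continuous_on_vec_lambda)

lemma positive_part_nonneg: "0 \<le> positive_part w"
  by (simp add: positive_part_def less_eq_vec_def)

lemma positive_part_ge: "w $ i \<le> positive_part w $ i"
  by (simp add: positive_part_def)

lemma norm_positive_part_le: "norm (positive_part w) \<le> norm w"
  by (rule norm_le_componentwise_cart) (auto simp: positive_part_def)

lemma inner_nonneg_vec:
  fixes u v :: "real^'n"
  assumes "0 \<le> u" "0 \<le> v"
  shows "0 \<le> u \<bullet> v"
  using assms by (auto simp: inner_vec_def less_eq_vec_def intro!: sum_nonneg)

lemma row_inner: "A $ i \<bullet> x = (A *v x) $ i" for A :: "real^'d^'n"
  by (simp add: matrix_vector_mult_def inner_vec_def)

lemma sum_row_inner: "(\<Sum>i\<in>UNIV. q $ i * (A $ i \<bullet> x)) = q \<bullet> (A *v x)" for A :: "real^'d^'n"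
  unfolding row_inner inner_vec_def[of q] by simp

lemma transpose_inner: "(transpose A *v q) \<bullet> x = q \<bullet> (A *v x)" for A :: "real^'d^'n"
  by (simp add: dot_lmul_matrix transpose_matrix_vector)

lemma average_in_convex:
  fixes z :: "nat \<Rightarrow> 'v::real_vector"
  assumes "convex C" "0 < T" "\<And>t. t < T \<Longrightarrow> z t \<in> C"
  shows "(1 / real T) *\<^sub>R (\<Sum>t<T. z t) \<in> C"
  unfolding scaleR_sum_right using assms by (intro convex_sum) auto

text \<open>
  Completing the square gives \<open>(m - p)\<^sup>2 \<le> p\<^sup>2 + c \<le> (p + sqrt c)\<^sup>2\<close>.
\<close>

lemma quadratic_bound_root:
  fixes m p c :: real
  assumes "m\<^sup>2 \<le> 2 * p * m + c" "0 \<le> p" "0 \<le> c"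
  shows "m \<le> 2 * p + sqrt c"
proof -
  have "(m - p)\<^sup>2 = m\<^sup>2 - 2 * p * m + p\<^sup>2" by (simp add: power2_diff)
  moreover have "(p + sqrt c)\<^sup>2 = p\<^sup>2 + 2 * (p * sqrt c) + c" using assms by (simp add: power2_sum)
  moreover have "0 \<le> p * sqrt c" using assms by simp
  ultimately have "(m - p)\<^sup>2 \<le> (p + sqrt c)\<^sup>2" using assms(1) by linarith
  then have "m - p \<le> p + sqrt c"
    by (rule power2_le_imp_le) (use assms in auto)
  then show ?thesis by simp
qed

section \<open>Decisions drawn from a Markov kernel\<close>

lemma integrable_bounded_identity:
  fixes C :: "'a::euclidean_space set"
  assumes "prob_space M" and sets: "sets M = sets borel" and "bounded C" and "AE x in M. x \<in> C"
  shows "integrable M (\<lambda>x. x)"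
proof -
  obtain R where "\<And>x. x \<in> C \<Longrightarrow> norm x \<le> R"
    using assms by (auto simp: bounded_iff)
  then show ?thesis
    using assms(4) by (intro finite_measure.integrable_const_bound[OF prob_space.finite_measure[OF assms(1)], where B=R])
      (auto simp: measurable_cong_sets[OF sets refl])
qed

text \<open>
  Fubini's theorem for a mixture of kernels concentrated on a compact set.  It is stated after taking
  the inner product with a fixed vector because the integration rule for \<open>bind\<close> is about bounded
  real functions; a vector is determined by its inner products.
\<close>

lemma inner_integral_bind:
  fixes \<kappa> :: "'s \<Rightarrow> 'a::euclidean_space measure"
  assumes \<nu>: "prob_space \<nu>" and \<kappa>: "\<kappa> \<in> \<nu> \<rightarrow>\<^sub>M prob_algebra borel"
    and C: "compact C" and conc: "\<And>s. s \<in> space \<nu> \<Longrightarrow> AE x in \<kappa> s. x \<in> C"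
  shows "AE x in \<nu> \<bind> \<kappa>. x \<in> C"
    and "integrable \<nu> (\<lambda>s. \<integral>x. c \<bullet> x \<partial>\<kappa> s)"
    and "c \<bullet> (\<integral>x. x \<partial>(\<nu> \<bind> \<kappa>)) = (\<integral>s. (\<integral>x. c \<bullet> x \<partial>\<kappa> s) \<partial>\<nu>)"
proof -
  interpret \<nu>: prob_space \<nu> by (rule \<nu>)
  have \<kappa>'[measurable]: "\<kappa> \<in> \<nu> \<rightarrow>\<^sub>M subprob_algebra borel" by (rule measurable_prob_algebraD[OF \<kappa>])
  have \<kappa>s: "prob_space (\<kappa> s)" "sets (\<kappa> s) = sets borel" if "s \<in> space \<nu>" for s
    using measurable_space[OF \<kappa> that] by (auto simp: space_prob_algebra)
  have C_sets[measurable]: "C \<in> sets borel" using C by (intro borel_closed compact_imp_closed)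
  show AE: "AE x in \<nu> \<bind> \<kappa>. x \<in> C"
    using conc by (subst AE_bind[OF \<kappa>']) (auto intro!: AE_I2)
  have sets_bind: "sets (\<nu> \<bind> \<kappa>) = sets borel"
    by (rule sets_bind[OF \<kappa>s(2) \<nu>.not_empty])
  interpret bind: prob_space "\<nu> \<bind> \<kappa>"
    by (rule \<nu>.prob_space_bind[OF _ \<kappa>']) (auto intro!: AE_I2 \<kappa>s)
  obtain R where R: "\<And>x. x \<in> C \<Longrightarrow> norm x \<le> R"
    using compact_imp_bounded[OF C] by (auto simp: bounded_iff)
  have id_int: "integrable (\<nu> \<bind> \<kappa>) (\<lambda>x. x)"
    by (rule integrable_bounded_identity[OF bind.prob_space_axioms sets_bind compact_imp_bounded[OF C] AE])
  \<comment> \<open>A bounded function on the whole space that agrees almost surely with the unbounded \<open>c \<bullet> x\<close>.\<close>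
  define h where "h x = indicator C x * (c \<bullet> x)" for x
  have h_meas: "h \<in> borel_measurable borel" unfolding h_def by measurable
  have h_bound: "\<bar>h x\<bar> \<le> norm c * \<bar>R\<bar>" for x
  proof (cases "x \<in> C")
    case True
    have "\<bar>c \<bullet> x\<bar> \<le> norm c * norm x" by (rule Cauchy_Schwarz_ineq2)
    also have "\<dots> \<le> norm c * \<bar>R\<bar>" using R[OF True] by (intro mult_left_mono) auto
    finally show ?thesis using True by (simp add: h_def)
  qed (simp add: h_def)
  have eq: "(\<integral>x. c \<bullet> x \<partial>\<kappa> s) = (\<integral>x. h x \<partial>\<kappa> s)" if "s \<in> space \<nu>" for s
    using conc[OF that] h_meas
    by (intro integral_cong_AE) (auto simp: measurable_cong_sets[OF \<kappa>s(2)[OF that] refl] h_def)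
  have "integrable \<nu> (\<lambda>s. \<integral>x. h x \<partial>\<kappa> s)"
  proof (rule \<nu>.integrable_const_bound[where B="norm c * \<bar>R\<bar>"])
    have h_meas'[measurable]: "h \<in> borel_measurable borel" by (rule h_meas)
    show "(\<lambda>s. \<integral>x. h x \<partial>\<kappa> s) \<in> borel_measurable \<nu>"
      by measurable
    show "AE s in \<nu>. norm (\<integral>x. h x \<partial>\<kappa> s) \<le> norm c * \<bar>R\<bar>"
    proof (rule AE_I2)
      fix s assume s: "s \<in> space \<nu>"
      interpret k: prob_space "\<kappa> s" by (rule \<kappa>s[OF s])
      have "integrable (\<kappa> s) h"
        using h_bound h_meas by (intro k.integrable_const_bound[where B="norm c * \<bar>R\<bar>"])
          (auto simp: measurable_cong_sets[OF \<kappa>s(2)[OF s] refl])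
      then have "(\<integral>x. \<bar>h x\<bar> \<partial>\<kappa> s) \<le> norm c * \<bar>R\<bar>"
        using h_bound by (intro k.integral_le_const) auto
      then show "norm (\<integral>x. h x \<partial>\<kappa> s) \<le> norm c * \<bar>R\<bar>"
        unfolding real_norm_def by (rule order_trans[OF integral_abs_bound])
    qed
  qed
  then show "integrable \<nu> (\<lambda>s. \<integral>x. c \<bullet> x \<partial>\<kappa> s)"
    by (subst Bochner_Integration.integrable_cong[OF refl eq])
  have "c \<bullet> (\<integral>x. x \<partial>(\<nu> \<bind> \<kappa>)) = (\<integral>x. c \<bullet> x \<partial>(\<nu> \<bind> \<kappa>))"
    using id_int by simp
  also have "\<dots> = (\<integral>x. h x \<partial>(\<nu> \<bind> \<kappa>))"
    using AE h_meas by (intro integral_cong_AE) (auto simp: measurable_cong_sets[OF sets_bind refl] h_def)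
  also have "\<dots> = (\<integral>s. (\<integral>x. h x \<partial>\<kappa> s) \<partial>\<nu>)"
    by (rule integral_bind[OF h_meas h_bound \<kappa>' \<nu>.finite_measure_axioms, where B'=1])
      (auto intro!: AE_I2 simp: prob_space.emeasure_space_1[OF \<kappa>s(1)])
  also have "\<dots> = (\<integral>s. (\<integral>x. c \<bullet> x \<partial>\<kappa> s) \<partial>\<nu>)"
    by (rule Bochner_Integration.integral_cong[OF refl eq[symmetric]])
  finally show "c \<bullet> (\<integral>x. x \<partial>(\<nu> \<bind> \<kappa>)) = (\<integral>s. (\<integral>x. c \<bullet> x \<partial>\<kappa> s) \<partial>\<nu>)" .
qed

section \<open>The closed region of stationary expectations\<close>

text \<open>
  The random states together with the decision sets, without objective or algorithm.
\<close>

locale decision_system = prob_space P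
  for P :: "'w measure"
    and S :: "nat \<Rightarrow> 'w \<Rightarrow> real^'m"
    and SS :: "(real^'m) set"
    and X :: "real^'m \<Rightarrow> (real^'d) set"
    and BB :: "(real^'d) set" +
  assumes iid: "iid_states P S SS"
    and compact_BB: "compact BB" and convex_BB: "convex BB"
    and options: "\<And>s. s \<in> SS \<Longrightarrow> compact (X s) \<and> X s \<noteq> {} \<and> X s \<subseteq> BB"
begin

text \<open>
  The states are measured by the trace of the Borel sets on \<open>SS\<close>, as in the definition of stationary
  kernels, because \<open>SS\<close> itself need not be Borel.  The lemmas up to \<open>indep_states\<close> transfer
  common law and independence from the Borel sets to this trace.
\<close>

abbreviation state_space :: "(real^'m) measure" where
  "state_space \<equiv> restrict_space borel SS"

definition state_law :: "(real^'m) measure" where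
  "state_law = distr P state_space (S 0)"

abbreviation region :: "(real^'d) set" where
  "region \<equiv> closed_region P S SS X"

lemma space_state_space [simp]: "space state_space = SS"
  by (simp add: space_restrict_space)

lemma space_state_law [simp]: "space state_law = SS"
  by (simp add: state_law_def)

lemma sets_state_law [measurable_cong, simp]: "sets state_law = sets state_space"
  by (simp add: state_law_def)

lemma state_in: "\<omega> \<in> space P \<Longrightarrow> S t \<omega> \<in> SS"
  using iid by (simp add: iid_states_def)

lemma measurable_state [measurable]: "S t \<in> P \<rightarrow>\<^sub>M state_space"
proof -
  have "S t \<in> borel_measurable P"
    using iid by (auto simp: iid_states_def indep_vars_def)
  then show ?thesis
    by (intro measurable_restrict_space2) (auto simp: state_in)
qed

lemma prob_space_state_law: "prob_space state_law"
  unfolding state_law_def by (rule prob_space_distr) measurable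

lemma preimage_trace:
  assumes "A \<in> sets state_space"
  obtains A' where "A' \<in> sets borel" and "\<And>t. S t -` A \<inter> space P = S t -` A' \<inter> space P"
proof -
  obtain A' where "A' \<in> sets borel" "A = SS \<inter> A'"
    using assms by (auto simp: sets_restrict_space)
  then have "S t -` A \<inter> space P = S t -` A' \<inter> space P" for t
    using state_in by auto
  with \<open>A' \<in> sets borel\<close> show ?thesis by (rule that)
qed

lemma distr_state: "distr P state_space (S t) = state_law"
proof (rule measure_eqI)
  fix A assume "A \<in> sets (distr P state_space (S t))"
  then have A: "A \<in> sets state_space" by simp
  then obtain A' where A': "A' \<in> sets borel" "\<And>t. S t -` A \<inter> space P = S t -` A' \<inter> space P"
    by (rule preimage_trace) blast
  have meas: "S t \<in> borel_measurable P" for t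
    using iid by (auto simp: iid_states_def indep_vars_def)
  have "emeasure (distr P state_space (S t)) A = emeasure (distr P borel (S t)) A'"
    using A A' meas by (simp add: emeasure_distr)
  also have "distr P borel (S t) = distr P borel (S 0)"
    using iid unfolding iid_states_def by blast
  also have "emeasure (distr P borel (S 0)) A' = emeasure state_law A"
    using A A' meas by (simp add: emeasure_distr state_law_def)
  finally show "emeasure (distr P state_space (S t)) A = emeasure state_law A" .
qed simp

lemma indep_states: "indep_vars (\<lambda>_. state_space) S UNIV"
proof -
  have "indep_vars (\<lambda>_. borel) S UNIV" using iid by (simp add: iid_states_def)
  then have "indep_sets (\<lambda>t. {S t -` A \<inter> space P | A. A \<in> sets borel}) UNIV"
    by (simp add: indep_vars_def2)
  then have "indep_sets (\<lambda>t. {S t -` A \<inter> space P | A. A \<in> sets state_space}) UNIV"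
  proof (rule indep_sets_mono_sets)
    fix t
    show "{S t -` A \<inter> space P | A. A \<in> sets state_space} \<subseteq> {S t -` A \<inter> space P | A. A \<in> sets borel}"
    proof
      fix E assume "E \<in> {S t -` A \<inter> space P | A. A \<in> sets state_space}"
      then obtain A where "A \<in> sets state_space" and E: "E = S t -` A \<inter> space P" by auto
      then obtain A' where "A' \<in> sets borel" "\<And>t. S t -` A \<inter> space P = S t -` A' \<inter> space P"
        by (elim preimage_trace) blast
      then show "E \<in> {S t -` A \<inter> space P | A. A \<in> sets borel}" unfolding E by auto
    qed
  qed
  then show ?thesis by (auto simp: indep_vars_def2)
qed

lemma stationary_expectations_eq:
  "stationary_expectations P (S 0) SS X =
     {(\<integral>x. x \<partial>(state_law \<bind> \<kappa>)) | \<kappa>. stationary_kernel SS X \<kappa>}"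
  by (simp add: stationary_expectations_def state_law_def)

lemma stationary_kernelD:
  assumes "stationary_kernel SS X \<kappa>"
  shows "\<kappa> \<in> state_law \<rightarrow>\<^sub>M prob_algebra borel"
    and "\<And>s. s \<in> SS \<Longrightarrow> prob_space (\<kappa> s)" and "\<And>s. s \<in> SS \<Longrightarrow> sets (\<kappa> s) = sets borel"
    and "\<And>s. s \<in> SS \<Longrightarrow> AE x in \<kappa> s. x \<in> X s"
    and "\<And>s. s \<in> SS \<Longrightarrow> AE x in \<kappa> s. x \<in> BB"
proof -
  show meas: "\<kappa> \<in> state_law \<rightarrow>\<^sub>M prob_algebra borel"
    using assms by (simp add: stationary_kernel_def measurable_cong_sets[OF sets_state_law refl])
  show "prob_space (\<kappa> s)" "sets (\<kappa> s) = sets borel" if "s \<in> SS" for s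
    using measurable_space[OF meas, of s] that by (auto simp: space_prob_algebra)
  show conc: "AE x in \<kappa> s. x \<in> X s" if "s \<in> SS" for s
    using assms that by (simp add: stationary_kernel_def)
  show "AE x in \<kappa> s. x \<in> BB" if "s \<in> SS" for s
    using conc[OF that] options[OF that] by (auto elim!: eventually_mono)
qed

text \<open>
  How the closed region enters the comparison of algorithms: a lower bound on a linear cost over the
  options of each state, averaged over the state, is a lower bound on the cost at every achievable
  mean.  This is clear for stationary kernels, and the inequality is preserved by limits.
\<close>

lemma region_lower_bound:
  assumes y: "y \<in> region"
    and w: "integrable state_law w"
    and le: "\<And>s x. s \<in> SS \<Longrightarrow> x \<in> X s \<Longrightarrow> w s \<le> c \<bullet> x"
  shows "(\<integral>s. w s \<partial>state_law) \<le> c \<bullet> y"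
proof -
  have "stationary_expectations P (S 0) SS X \<subseteq> {y. (\<integral>s. w s \<partial>state_law) \<le> c \<bullet> y}"
  proof
    fix y assume "y \<in> stationary_expectations P (S 0) SS X"
    then obtain \<kappa> where \<kappa>: "stationary_kernel SS X \<kappa>" and y: "y = (\<integral>x. x \<partial>(state_law \<bind> \<kappa>))"
      by (auto simp: stationary_expectations_eq)
    note k = stationary_kernelD[OF \<kappa>]
    note bind = inner_integral_bind(2,3)[OF prob_space_state_law k(1) compact_BB, where c=c]
    have "w s \<le> (\<integral>x. c \<bullet> x \<partial>\<kappa> s)" if s: "s \<in> SS" for s
    proof (rule prob_space.integral_ge_const[OF k(2)[OF s]])
      show "integrable (\<kappa> s) (\<lambda>x. c \<bullet> x)"
        using integrable_bounded_identity[OF k(2)[OF s] k(3)[OF s] compact_imp_bounded[OF compact_BB] k(5)[OF s]]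
        by simp
      show "AE x in \<kappa> s. w s \<le> c \<bullet> x"
        using k(4)[OF s] le[OF s] by (auto elim!: eventually_mono)
    qed
    then have "(\<integral>s. w s \<partial>state_law) \<le> (\<integral>s. (\<integral>x. c \<bullet> x \<partial>\<kappa> s) \<partial>state_law)"
      using w bind(1) k(5) by (intro integral_mono) auto
    also have "\<dots> = c \<bullet> y" unfolding y using bind(2) k(5) by simp
    finally show "y \<in> {y. (\<integral>s. w s \<partial>state_law) \<le> c \<bullet> y}" by simp
  qed
  moreover have "closed {y. (\<integral>s. w s \<partial>state_law) \<le> c \<bullet> y}"
    using closed_halfspace_ge[of "(\<integral>s. w s \<partial>state_law)" c] by simp
  ultimately have "region \<subseteq> {y. (\<integral>s. w s \<partial>state_law) \<le> c \<bullet> y}"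
    unfolding closed_region_def by (rule closure_minimal)
  then show ?thesis using y by auto
qed

text \<open>
  A point outside the compact convex set \<open>BB\<close> is separated from it by a hyperplane, that is, by a
  linear cost with a constant lower bound on all options.
\<close>

lemma region_subset: "region \<subseteq> BB"
proof (rule ccontr)
  assume "\<not> region \<subseteq> BB"
  then obtain y where y: "y \<in> region" "y \<notin> BB" by auto
  then obtain c \<beta> where c: "c \<bullet> y < \<beta>" "\<And>x. x \<in> BB \<Longrightarrow> \<beta> < c \<bullet> x"
    using separating_hyperplane_closed_point[OF convex_BB compact_imp_closed[OF compact_BB]] by metis
  interpret law: prob_space state_law by (rule prob_space_state_law)
  have "(\<integral>s. \<beta> \<partial>state_law) \<le> c \<bullet> y"
    using options c(2) by (intro region_lower_bound[OF y(1)]) (auto intro: less_imp_le)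
  then show False using c(1) law.prob_space by simp
qed

text \<open>
  A stationary algorithm may draw a private random seed in every slot.  Mixing over two seeds shows
  that the region is convex; taking for the seed an independent copy of the algorithm's memory
  shows that the mean decision of the algorithm lies in the region.
\<close>

lemma seeded_kernel:
  fixes H :: "'h measure" and \<kappa> :: "(real^'m) \<times> 'h \<Rightarrow> (real^'d) measure"
  assumes H: "prob_space H"
    and \<kappa>: "\<kappa> \<in> state_space \<Otimes>\<^sub>M H \<rightarrow>\<^sub>M prob_algebra borel"
    and conc: "\<And>s h. s \<in> SS \<Longrightarrow> h \<in> space H \<Longrightarrow> AE x in \<kappa> (s, h). x \<in> X s"
  shows "\<exists>y\<in>stationary_expectations P (S 0) SS X.
    \<forall>c. c \<bullet> y = (\<integral>s. \<integral>h. \<integral>x. c \<bullet> x \<partial>\<kappa> (s, h) \<partial>H \<partial>state_law)"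
proof -
  define \<kappa>' where "\<kappa>' s = H \<bind> (\<lambda>h. \<kappa> (s, h))" for s
  have slice: "(\<lambda>h. \<kappa> (s, h)) \<in> H \<rightarrow>\<^sub>M prob_algebra borel" if "s \<in> SS" for s
    using \<kappa> that by (auto intro: measurable_compose[OF _ \<kappa>])
  have "(\<lambda>s. H) \<in> state_space \<rightarrow>\<^sub>M prob_algebra H"
    using H by (intro measurable_const) (simp add: space_prob_algebra)
  then have "\<kappa>' \<in> state_space \<rightarrow>\<^sub>M prob_algebra borel"
    unfolding \<kappa>'_def using \<kappa> by (intro measurable_bind_prob_space2[where N=H]) auto
  moreover have "AE x in \<kappa>' s. x \<in> X s" if s: "s \<in> SS" for s
  proof -
    have "compact (X s)" using options[OF s] by simp
    then show ?thesis unfolding \<kappa>'_def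
      by (rule inner_integral_bind(1)[OF H slice[OF s]]) (rule conc[OF s])
  qed
  ultimately have kernel: "stationary_kernel SS X \<kappa>'" by (simp add: stationary_kernel_def)
  note k = stationary_kernelD[OF kernel]
  have "c \<bullet> (\<integral>x. x \<partial>(state_law \<bind> \<kappa>')) = (\<integral>s. \<integral>h. \<integral>x. c \<bullet> x \<partial>\<kappa> (s, h) \<partial>H \<partial>state_law)" for c
  proof -
    have "c \<bullet> (\<integral>x. x \<partial>(state_law \<bind> \<kappa>')) = (\<integral>s. \<integral>x. c \<bullet> x \<partial>\<kappa>' s \<partial>state_law)"
      by (rule inner_integral_bind(3)[OF prob_space_state_law k(1) compact_BB]) (simp add: k(5))
    also have "\<dots> = (\<integral>s. \<integral>h. \<integral>x. c \<bullet> x \<partial>\<kappa> (s, h) \<partial>H \<partial>state_law)"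
    proof (intro Bochner_Integration.integral_cong refl)
      fix s assume "s \<in> space state_law"
      then have s: "s \<in> SS" by simp
      have X: "compact (X s)" using options[OF s] by simp
      have "(\<integral>x. c \<bullet> x \<partial>\<kappa>' s) = c \<bullet> (\<integral>x. x \<partial>\<kappa>' s)"
        using integrable_bounded_identity[OF k(2)[OF s] k(3)[OF s] compact_imp_bounded[OF compact_BB] k(5)[OF s]]
        by simp
      also have "\<dots> = (\<integral>h. \<integral>x. c \<bullet> x \<partial>\<kappa> (s, h) \<partial>H)"
        unfolding \<kappa>'_def by (rule inner_integral_bind(3)[OF H slice[OF s] X]) (rule conc[OF s])
      finally show "(\<integral>x. c \<bullet> x \<partial>\<kappa>' s) = (\<integral>h. \<integral>x. c \<bullet> x \<partial>\<kappa> (s, h) \<partial>H)" .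
    qed
    finally show ?thesis .
  qed
  moreover have "(\<integral>x. x \<partial>(state_law \<bind> \<kappa>')) \<in> stationary_expectations P (S 0) SS X"
    using kernel by (auto simp: stationary_expectations_eq)
  ultimately show ?thesis by blast
qed

lemma convex_region: "convex region"
  unfolding closed_region_def
proof (rule convex_closure, rule convexI)
  fix y1 y2 and u v :: real
  assume y1: "y1 \<in> stationary_expectations P (S 0) SS X" and y2: "y2 \<in> stationary_expectations P (S 0) SS X"
    and uv: "0 \<le> u" "0 \<le> v" "u + v = 1"
  obtain \<kappa>1 where \<kappa>1: "stationary_kernel SS X \<kappa>1" and y1: "y1 = (\<integral>x. x \<partial>(state_law \<bind> \<kappa>1))"
    using y1 by (auto simp: stationary_expectations_eq)
  obtain \<kappa>2 where \<kappa>2: "stationary_kernel SS X \<kappa>2" and y2: "y2 = (\<integral>x. x \<partial>(state_law \<bind> \<kappa>2))"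
    using y2 by (auto simp: stationary_expectations_eq)
  have meas: "\<kappa>1 \<in> state_space \<rightarrow>\<^sub>M prob_algebra borel" "\<kappa>2 \<in> state_space \<rightarrow>\<^sub>M prob_algebra borel"
    using \<kappa>1 \<kappa>2 by (simp_all add: stationary_kernel_def)
  define H where "H = measure_pmf (bernoulli_pmf u)"
  have sets_H[measurable_cong]: "sets H = sets (count_space UNIV)" by (simp add: H_def)
  define \<kappa> where "\<kappa> = (\<lambda>(s, h). if h then \<kappa>1 s else \<kappa>2 s)"
  have "\<kappa> \<in> state_space \<Otimes>\<^sub>M H \<rightarrow>\<^sub>M prob_algebra borel"
    unfolding \<kappa>_def using meas by measurable
  moreover have "AE x in \<kappa> (s, h). x \<in> X s" if "s \<in> SS" "h \<in> space H" for s h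
  proof -
    have "\<kappa> (s, h) = \<kappa>1 s \<or> \<kappa> (s, h) = \<kappa>2 s" by (simp add: \<kappa>_def)
    then show ?thesis
      using stationary_kernelD(4)[OF \<kappa>1 that(1)] stationary_kernelD(4)[OF \<kappa>2 that(1)] by metis
  qed
  moreover have "prob_space H" by (simp add: H_def prob_space_measure_pmf)
  ultimately obtain y where y: "y \<in> stationary_expectations P (S 0) SS X"
    and y_eq: "\<And>c. c \<bullet> y = (\<integral>s. \<integral>h. \<integral>x. c \<bullet> x \<partial>\<kappa> (s, h) \<partial>H \<partial>state_law)"
    using seeded_kernel[of H \<kappa>] by blast
  have "c \<bullet> y = c \<bullet> (u *\<^sub>R y1 + v *\<^sub>R y2)" for c
  proof -
    note bind1 = inner_integral_bind(2,3)[OF prob_space_state_law stationary_kernelD(1)[OF \<kappa>1] compact_BB, where c=c]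
    note bind2 = inner_integral_bind(2,3)[OF prob_space_state_law stationary_kernelD(1)[OF \<kappa>2] compact_BB, where c=c]
    note conc = stationary_kernelD(5)[OF \<kappa>1] stationary_kernelD(5)[OF \<kappa>2]
    have "(\<integral>h. \<integral>x. c \<bullet> x \<partial>\<kappa> (s, h) \<partial>H) = u * (\<integral>x. c \<bullet> x \<partial>\<kappa>1 s) + v * (\<integral>x. c \<bullet> x \<partial>\<kappa>2 s)" for s
      using uv unfolding H_def by (subst integral_bernoulli_pmf) (auto simp: \<kappa>_def)
    then have "c \<bullet> y = (\<integral>s. u * (\<integral>x. c \<bullet> x \<partial>\<kappa>1 s) + v * (\<integral>x. c \<bullet> x \<partial>\<kappa>2 s) \<partial>state_law)"
      by (simp add: y_eq)
    also have "\<dots> = u * (c \<bullet> y1) + v * (c \<bullet> y2)"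
      unfolding y1 y2 using bind1 bind2 conc by simp
    finally show ?thesis by (simp add: inner_add_right)
  qed
  then have "y = u *\<^sub>R y1 + v *\<^sub>R y2" using vector_eq_ldot by blast
  then show "u *\<^sub>R y1 + v *\<^sub>R y2 \<in> stationary_expectations P (S 0) SS X" using y by simp
qed

end

section \<open>The auxiliary point and the queues as functions of past states\<close>

text \<open>
  A run with arbitrary weight \<open>V\<close> and step size \<open>\<eta>\<close>; these are tied to the horizon only at the end.
  As in \<open>algorithm_run\<close>, the index of \<open>\<gamma>\<close> is shifted, so that \<open>\<gamma> t\<close> and \<open>Q t\<close> are both known before
  slot \<open>t\<close>.
\<close>

locale frank_wolfe_run = decision_system P S SS X BB
  for P :: "'w measure"
    and S :: "nat \<Rightarrow> 'w \<Rightarrow> real^'m"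
    and SS :: "(real^'m) set"
    and X :: "real^'m \<Rightarrow> (real^'d) set"
    and BB :: "(real^'d) set" +
  fixes f :: "real^'d \<Rightarrow> real"
    and gradf :: "real^'d \<Rightarrow> real^'d"
    and A :: "real^'d^'n"
    and b :: "real^'n"
    and K M D B L V \<eta> :: real
    and x \<gamma> :: "nat \<Rightarrow> 'w \<Rightarrow> real^'d"
    and Q :: "nat \<Rightarrow> 'w \<Rightarrow> real^'n"
  assumes zero_in_region: "0 \<in> region"
    and deriv: "\<And>y. y \<in> BB \<Longrightarrow> (f has_derivative (\<lambda>h. gradf y \<bullet> h)) (at y within BB)"
    and lip: "L-lipschitz_on BB gradf"
    and gradf_le: "\<And>y. y \<in> BB \<Longrightarrow> norm (gradf y) \<le> M"
    and f_le: "\<And>y. y \<in> BB \<Longrightarrow> \<bar>f y\<bar> \<le> K"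
    and slack_le: "\<And>y. y \<in> BB \<Longrightarrow> (\<Sum>i\<in>UNIV. \<bar>A $ i \<bullet> y - b $ i\<bar>\<^sup>2) \<le> B\<^sup>2"
    and diam: "\<And>y z. y \<in> BB \<Longrightarrow> z \<in> BB \<Longrightarrow> norm (y - z) \<le> D"
    and convex_f: "convex_on BB f"
    and V_pos: "0 < V" and \<eta>_pos: "0 < \<eta>" and \<eta>_le: "\<eta> \<le> 1"
    and run: "algorithm_run P S SS X BB gradf A b V \<eta> x \<gamma> Q"
begin

text \<open>
  One fixed choice of the decision functions whose existence is part of \<open>algorithm_run\<close>.
\<close>

definition policy :: "nat \<Rightarrow> real^'d \<Rightarrow> real^'n \<Rightarrow> real^'m \<Rightarrow> real^'d" where
  "policy = (SOME choice. (\<forall>t. decision_rule SS X BB gradf A V (choice t)) \<and>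
      (\<forall>\<omega>\<in>space P. \<gamma> 0 \<omega> = 0 \<and> Q 0 \<omega> = 0 \<and>
         (\<forall>t. x t \<omega> = choice t (\<gamma> t \<omega>) (Q t \<omega>) (S t \<omega>) \<and>
              \<gamma> (Suc t) \<omega> = (1 - \<eta>) *\<^sub>R \<gamma> t \<omega> + \<eta> *\<^sub>R x t \<omega> \<and>
              (\<forall>i. Q (Suc t) \<omega> $ i = max (Q t \<omega> $ i + A $ i \<bullet> x t \<omega> - b $ i) 0))))"

lemma run_recursion:
  shows policy_decision_rule: "decision_rule SS X BB gradf A V (policy t)"
    and \<gamma>_0: "\<omega> \<in> space P \<Longrightarrow> \<gamma> 0 \<omega> = 0"
    and Q_0: "\<omega> \<in> space P \<Longrightarrow> Q 0 \<omega> = 0"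
    and x_eq: "\<omega> \<in> space P \<Longrightarrow> x t \<omega> = policy t (\<gamma> t \<omega>) (Q t \<omega>) (S t \<omega>)"
    and \<gamma>_Suc: "\<omega> \<in> space P \<Longrightarrow> \<gamma> (Suc t) \<omega> = (1 - \<eta>) *\<^sub>R \<gamma> t \<omega> + \<eta> *\<^sub>R x t \<omega>"
    and Q_Suc: "\<omega> \<in> space P \<Longrightarrow> Q (Suc t) \<omega> = positive_part (Q t \<omega> + (A *v x t \<omega> - b))"
proof -
  note * = someI_ex[OF run[unfolded algorithm_run_def], folded policy_def]
  show "decision_rule SS X BB gradf A V (policy t)" using * by blast
  assume \<omega>: "\<omega> \<in> space P"
  show "\<gamma> 0 \<omega> = 0" "Q 0 \<omega> = 0" "x t \<omega> = policy t (\<gamma> t \<omega>) (Q t \<omega>) (S t \<omega>)"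
    "\<gamma> (Suc t) \<omega> = (1 - \<eta>) *\<^sub>R \<gamma> t \<omega> + \<eta> *\<^sub>R x t \<omega>"
    using * \<omega> by blast+
  have "\<forall>i. Q (Suc t) \<omega> $ i = max (Q t \<omega> $ i + A $ i \<bullet> x t \<omega> - b $ i) 0"
    using * \<omega> by blast
  then show "Q (Suc t) \<omega> = positive_part (Q t \<omega> + (A *v x t \<omega> - b))"
    by (simp add: vec_eq_iff positive_part_def row_inner algebra_simps)
qed

text \<open>
  The coefficient vector of the linear functional that is minimized in a slot that starts with auxiliary
  point \<open>fst z\<close> and queues \<open>snd z\<close>.
\<close>

definition cost :: "(real^'d) \<times> (real^'n) \<Rightarrow> real^'d" where
  "cost z = V *\<^sub>R gradf (fst z) + transpose A *v snd z"

lemma cost_inner: "cost z \<bullet> y = V * (gradf (fst z) \<bullet> y) + snd z \<bullet> (A *v y)"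
  unfolding cost_def inner_add_left transpose_inner by simp

abbreviation history_space :: "((real^'d) \<times> (real^'n)) measure" where
  "history_space \<equiv> restrict_space borel (BB \<times> {0..})"

lemma space_history_space [simp]: "space history_space = BB \<times> {0..}"
  by (simp add: space_restrict_space)

lemma policy_in:
  assumes "z \<in> BB \<times> {0..}" "s \<in> SS"
  shows "policy t (fst z) (snd z) s \<in> X s" and "policy t (fst z) (snd z) s \<in> BB"
    and "y \<in> X s \<Longrightarrow> cost z \<bullet> policy t (fst z) (snd z) s \<le> cost z \<bullet> y"
proof -
  have "is_arg_min (\<lambda>x. V * (gradf (fst z) \<bullet> x) + (\<Sum>i\<in>UNIV. snd z $ i * (A $ i \<bullet> x)))
          (\<lambda>x. x \<in> X s) (policy t (fst z) (snd z) s)"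
    using policy_decision_rule[of t] assms by (auto simp: decision_rule_def)
  then have "is_arg_min (\<lambda>x. cost z \<bullet> x) (\<lambda>x. x \<in> X s) (policy t (fst z) (snd z) s)"
    by (simp only: cost_inner sum_row_inner)
  then show "policy t (fst z) (snd z) s \<in> X s"
    and "y \<in> X s \<Longrightarrow> cost z \<bullet> policy t (fst z) (snd z) s \<le> cost z \<bullet> y"
    by (auto simp: is_arg_min_linorder)
  then show "policy t (fst z) (snd z) s \<in> BB" using options[OF assms(2)] by auto
qed

lemma zero_in_BB: "0 \<in> BB"
  using zero_in_region region_subset by auto

lemma history_in: "\<omega> \<in> space P \<Longrightarrow> (\<gamma> t \<omega>, Q t \<omega>) \<in> BB \<times> {0..}"
proof (induction t)
  case 0
  then show ?case by (simp add: \<gamma>_0 Q_0 zero_in_BB)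
next
  case (Suc t)
  then have \<gamma>: "\<gamma> t \<omega> \<in> BB" and x: "x t \<omega> \<in> BB"
    using policy_in(2)[of "(\<gamma> t \<omega>, Q t \<omega>)" "S t \<omega>" t] by (auto simp: x_eq state_in)
  have "\<gamma> (Suc t) \<omega> \<in> BB"
    using convexD_alt[OF convex_BB \<gamma> x, of \<eta>] \<eta>_pos \<eta>_le Suc.prems by (simp add: \<gamma>_Suc)
  then show ?case using Suc.prems by (simp add: Q_Suc positive_part_nonneg)
qed

lemma \<gamma>_in: "\<omega> \<in> space P \<Longrightarrow> \<gamma> t \<omega> \<in> BB"
  and Q_nonneg: "\<omega> \<in> space P \<Longrightarrow> 0 \<le> Q t \<omega>"
  using history_in[of \<omega> t] by auto

lemma x_in: "\<omega> \<in> space P \<Longrightarrow> x t \<omega> \<in> BB"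
  using policy_in(2)[OF history_in state_in] by (simp add: x_eq)

lemma policy_measurable:
  "(\<lambda>(s, z). policy t (fst z) (snd z) s) \<in> borel_measurable (state_space \<Otimes>\<^sub>M history_space)"
proof -
  let ?R = "restrict_space borel (BB \<times> {0..} \<times> SS) :: ((real^'d) \<times> (real^'n) \<times> (real^'m)) measure"
  have fst: "fst \<in> history_space \<rightarrow>\<^sub>M borel" and snd: "snd \<in> history_space \<rightarrow>\<^sub>M borel"
    by (intro measurable_restrict_space1 borel_measurable_continuous_onI continuous_intros)+
  have "(\<lambda>p. fst p) \<in> state_space \<Otimes>\<^sub>M history_space \<rightarrow>\<^sub>M borel"
    by (rule measurable_compose[OF measurable_fst]) (simp add: measurable_restrict_space1)
  then have "(\<lambda>p. (fst (snd p), snd (snd p), fst p)) \<in> state_space \<Otimes>\<^sub>M history_space \<rightarrow>\<^sub>M borel"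
    by (intro borel_measurable_Pair measurable_compose[OF measurable_snd fst] measurable_compose[OF measurable_snd snd])
  then have "(\<lambda>p. (fst (snd p), snd (snd p), fst p)) \<in> state_space \<Otimes>\<^sub>M history_space \<rightarrow>\<^sub>M ?R"
    by (rule measurable_restrict_space2[rotated]) (auto simp: space_pair_measure)
  moreover have "(\<lambda>(g, q, s). policy t g q s) \<in> ?R \<rightarrow>\<^sub>M borel"
    using policy_decision_rule[of t] by (simp add: decision_rule_def)
  ultimately have "(\<lambda>p. (\<lambda>(g, q, s). policy t g q s) (fst (snd p), snd (snd p), fst p)) \<in> borel_measurable (state_space \<Otimes>\<^sub>M history_space)"
    by (rule measurable_compose)
  then show ?thesis by (simp add: case_prod_beta')
qed

text \<open>
  The recursion of the algorithm with the random states replaced by an arbitrary state sequence.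
  Since \<open>history t\<close> depends only on the first \<open>t\<close> entries, it exhibits the memory before slot \<open>t\<close> as a
  measurable function of the earlier states, which yields both its measurability and its
  independence of the current state.
\<close>

primrec history :: "nat \<Rightarrow> (nat \<Rightarrow> real^'m) \<Rightarrow> (real^'d) \<times> (real^'n)" where
  "history 0 s = (0, 0)"
| "history (Suc t) s =
     (let z = history t s; y = policy t (fst z) (snd z) (s t)
      in ((1 - \<eta>) *\<^sub>R fst z + \<eta> *\<^sub>R y, positive_part (snd z + (A *v y - b))))"

lemma history_eq: "\<omega> \<in> space P \<Longrightarrow> (\<gamma> t \<omega>, Q t \<omega>) = history t (\<lambda>i. S i \<omega>)"
proof (induction t)
  case (Suc t)
  then show ?case
    using Suc.IH[OF Suc.prems, symmetric] by (simp add: \<gamma>_Suc Q_Suc x_eq Let_def)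
qed (simp add: \<gamma>_0 Q_0)

lemma history_cong: "(\<And>i. i < t \<Longrightarrow> s i = s' i) \<Longrightarrow> history t s = history t s'"
  by (induction t) (auto simp: Let_def)

text \<open>
  The index set \<open>I\<close> is left free because the induction step evaluates \<open>history t\<close> on sequences that are
  one entry longer than it needs.
\<close>

lemma history_measurable:
  "{..<t} \<subseteq> I \<Longrightarrow> history t \<in> Pi\<^sub>M I (\<lambda>_. state_space) \<rightarrow>\<^sub>M history_space"
proof (induction t)
  case 0
  show ?case using zero_in_BB by (auto intro!: measurable_const simp: history.simps[abs_def])
next
  case (Suc t)
  let ?M = "Pi\<^sub>M I (\<lambda>_. state_space)"
  have IH: "history t \<in> ?M \<rightarrow>\<^sub>M history_space" using Suc by (auto simp: subset_iff)
  have s: "(\<lambda>s. s t) \<in> ?M \<rightarrow>\<^sub>M state_space"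
    using Suc.prems by (intro measurable_component_singleton) auto
  have z: "history t s \<in> BB \<times> {0..}" "s t \<in> SS" if "s \<in> space ?M" for s
    using measurable_space[OF IH that] measurable_space[OF s that] by auto
  let ?y = "\<lambda>s. policy t (fst (history t s)) (snd (history t s)) (s t)"
  have fst[measurable]: "(\<lambda>s. fst (history t s)) \<in> borel_measurable ?M"
    and snd[measurable]: "(\<lambda>s. snd (history t s)) \<in> borel_measurable ?M"
    by (rule measurable_compose[OF IH], intro measurable_restrict_space1 borel_measurable_continuous_onI continuous_intros)+
  have y[measurable]: "?y \<in> borel_measurable ?M"
    using measurable_compose[OF measurable_Pair[OF s IH] policy_measurable[of t]] by simp
  have Ay[measurable]: "(\<lambda>s. A *v ?y s) \<in> borel_measurable ?M"
    by (rule measurable_compose[OF y borel_measurable_continuous_onI])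
      (rule matrix_vector_mult_linear_continuous_on)
  have pos[measurable]: "positive_part \<in> borel_measurable borel"
    by (rule borel_measurable_continuous_onI[OF continuous_positive_part])
  have "(\<lambda>s. history (Suc t) s) \<in> borel_measurable ?M"
    unfolding history.simps Let_def
    by (intro borel_measurable_Pair) measurable
  then show ?case
  proof (rule measurable_restrict_space2[rotated], intro funcsetI)
    fix s assume s: "s \<in> space ?M"
    have "?y s \<in> BB" using policy_in(2)[OF z[OF s]] by simp
    then show "history (Suc t) s \<in> BB \<times> {0..}"
      using convexD_alt[OF convex_BB _ \<open>?y s \<in> BB\<close>, of "fst (history t s)" \<eta>] z(1)[OF s] \<eta>_pos \<eta>_le
      by (auto simp: Let_def positive_part_nonneg mem_Times_iff)
  qed
qed

abbreviation Z :: "nat \<Rightarrow> 'w \<Rightarrow> (real^'d) \<times> (real^'n)" where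
  "Z t \<omega> \<equiv> (\<gamma> t \<omega>, Q t \<omega>)"

definition history_law :: "nat \<Rightarrow> ((real^'d) \<times> (real^'n)) measure" where
  "history_law t = distr P history_space (Z t)"

lemma sets_history_law [measurable_cong, simp]: "sets (history_law t) = sets history_space"
  by (simp add: history_law_def)

lemma space_history_law [simp]: "space (history_law t) = BB \<times> {0..}"
  by (simp add: history_law_def)

lemma measurable_states_prefix: "(\<lambda>\<omega>. \<lambda>i\<in>I. S i \<omega>) \<in> P \<rightarrow>\<^sub>M Pi\<^sub>M I (\<lambda>_. state_space)"
  by (intro measurable_restrict measurable_state)

lemma Z_eq_prefix: "\<omega> \<in> space P \<Longrightarrow> Z t \<omega> = history t (\<lambda>i\<in>{..<t}. S i \<omega>)"
  unfolding history_eq by (rule history_cong) simp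

lemma measurable_Z [measurable]: "Z t \<in> P \<rightarrow>\<^sub>M history_space"
proof -
  have "(\<lambda>\<omega>. history t (\<lambda>i\<in>{..<t}. S i \<omega>)) \<in> P \<rightarrow>\<^sub>M history_space"
    by (rule measurable_compose[OF measurable_states_prefix history_measurable]) simp
  then show ?thesis by (subst measurable_cong[OF Z_eq_prefix])
qed

lemma measurable_\<gamma> [measurable]: "\<gamma> t \<in> borel_measurable P"
  and measurable_Q [measurable]: "Q t \<in> borel_measurable P"
proof -
  have "fst \<in> borel_measurable history_space" "snd \<in> borel_measurable history_space"
    by (intro measurable_restrict_space1 borel_measurable_continuous_onI continuous_intros)+
  from this[THEN measurable_compose[OF measurable_Z[of t]]]
  show "\<gamma> t \<in> borel_measurable P" "Q t \<in> borel_measurable P" by simp_all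
qed

lemma measurable_x [measurable]: "x t \<in> borel_measurable P"
proof -
  have "(\<lambda>\<omega>. policy t (\<gamma> t \<omega>) (Q t \<omega>) (S t \<omega>)) \<in> borel_measurable P"
    using measurable_compose[OF measurable_Pair[OF measurable_state measurable_Z] policy_measurable[of t]] by simp
  then show ?thesis by (subst measurable_cong[OF x_eq])
qed

lemma prob_space_history_law: "prob_space (history_law t)"
  unfolding history_law_def by (rule prob_space_distr) measurable

text \<open>
  The blocks \<open>{t}\<close> and \<open>{..<t}\<close> of independent states have a product law, and the current state and
  the memory are functions of one block each.
\<close>

lemma joint_law: "distr P (state_space \<Otimes>\<^sub>M history_space) (\<lambda>\<omega>. (S t \<omega>, Z t \<omega>)) = state_law \<Otimes>\<^sub>M history_law t"
proof -
  let ?N = "\<lambda>I. Pi\<^sub>M I (\<lambda>_::nat. state_space)"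
  let ?U = "\<lambda>\<omega>. \<lambda>i\<in>{t}. S i \<omega>" and ?W = "\<lambda>\<omega>. \<lambda>i\<in>{..<t}. S i \<omega>"
  have "indep_var (?N {t}) ?U (?N {..<t}) ?W"
    by (rule indep_var_restrict[OF indep_states]) auto
  then have prefix: "distr P (?N {t}) ?U \<Otimes>\<^sub>M distr P (?N {..<t}) ?W
      = distr P (?N {t} \<Otimes>\<^sub>M ?N {..<t}) (\<lambda>\<omega>. (?U \<omega>, ?W \<omega>))"
    by (simp add: indep_var_distribution_eq)
  have U: "?U \<in> P \<rightarrow>\<^sub>M ?N {t}" and W: "?W \<in> P \<rightarrow>\<^sub>M ?N {..<t}"
    by (rule measurable_states_prefix)+
  have s: "(\<lambda>s. s t) \<in> ?N {t} \<rightarrow>\<^sub>M state_space" and z: "history t \<in> ?N {..<t} \<rightarrow>\<^sub>M history_space"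
    by (auto intro: measurable_component_singleton history_measurable)
  have law_S: "state_law = distr (distr P (?N {t}) ?U) state_space (\<lambda>s. s t)"
    using U s by (simp add: distr_distr comp_def distr_state)
  have law_Z: "history_law t = distr (distr P (?N {..<t}) ?W) history_space (history t)"
    using W z unfolding history_law_def
    by (simp add: distr_distr comp_def) (intro distr_cong refl, simp add: Z_eq_prefix)
  have "state_law \<Otimes>\<^sub>M history_law t
      = distr (distr P (?N {t}) ?U \<Otimes>\<^sub>M distr P (?N {..<t}) ?W) (state_space \<Otimes>\<^sub>M history_space)
          (\<lambda>(u, w). (u t, history t w))"
    unfolding law_S law_Z
    using s z prob_space_history_law[of t] unfolding law_Z
    by (intro pair_measure_distr prob_space_imp_sigma_finite) auto
  also have "\<dots> = distr P (state_space \<Otimes>\<^sub>M history_space) ((\<lambda>(u, w). (u t, history t w)) \<circ> (\<lambda>\<omega>. (?U \<omega>, ?W \<omega>)))"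
    unfolding prefix
    by (intro distr_distr measurable_Pair U W)
      (auto simp: case_prod_beta' intro!: measurable_Pair measurable_compose[OF measurable_fst s] measurable_compose[OF measurable_snd z])
  also have "\<dots> = distr P (state_space \<Otimes>\<^sub>M history_space) (\<lambda>\<omega>. (S t \<omega>, Z t \<omega>))"
    by (intro distr_cong refl) (simp add: Z_eq_prefix)
  finally show ?thesis ..
qed

section \<open>Integrability along a run\<close>

text \<open>
  All quantities of a run are bounded in each slot, so integrability reduces to measurability.
\<close>

lemma integrable_inner:
  fixes u v :: "'w \<Rightarrow> 'a::euclidean_space"
  assumes [measurable]: "u \<in> borel_measurable P" "v \<in> borel_measurable P"
    and u: "\<And>\<omega>. \<omega> \<in> space P \<Longrightarrow> norm (u \<omega>) \<le> p"
    and v: "\<And>\<omega>. \<omega> \<in> space P \<Longrightarrow> norm (v \<omega>) \<le> q"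
  shows "integrable P (\<lambda>\<omega>. u \<omega> \<bullet> v \<omega>)"
proof (rule integrable_const_bound[where B="p * q"])
  show "AE \<omega> in P. norm (u \<omega> \<bullet> v \<omega>) \<le> p * q"
  proof (rule AE_I2)
    fix \<omega> assume \<omega>: "\<omega> \<in> space P"
    have "norm (u \<omega> \<bullet> v \<omega>) \<le> norm (u \<omega>) * norm (v \<omega>)" by (simp add: Cauchy_Schwarz_ineq2)
    also have "\<dots> \<le> p * q"
      using u[OF \<omega>] v[OF \<omega>] order_trans[OF norm_ge_zero u[OF \<omega>]] by (intro mult_mono) auto
    finally show "norm (u \<omega> \<bullet> v \<omega>) \<le> p * q" .
  qed
qed measurable

lemma BB_norm_le: "y \<in> BB \<Longrightarrow> norm y \<le> D"
  using diam[of y 0] zero_in_BB by simp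

lemma integrable_in_BB:
  assumes "u \<in> borel_measurable P" "\<And>\<omega>. \<omega> \<in> space P \<Longrightarrow> u \<omega> \<in> BB"
  shows "integrable P u"
  using assms BB_norm_le by (intro integrable_const_bound[where B=D]) auto

lemma integrable_\<gamma> [simp]: "integrable P (\<gamma> t)" and integrable_x [simp]: "integrable P (x t)"
  by (auto intro!: integrable_in_BB \<gamma>_in x_in)

lemma measurable_continuous_in_BB:
  fixes h :: "real^'d \<Rightarrow> 'b::topological_space"
  assumes h: "continuous_on BB h" and u: "u \<in> borel_measurable P" "\<And>\<omega>. \<omega> \<in> space P \<Longrightarrow> u \<omega> \<in> BB"
  shows "(\<lambda>\<omega>. h (u \<omega>)) \<in> borel_measurable P"
proof -
  have "u \<in> P \<rightarrow>\<^sub>M restrict_space borel BB"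
    using u by (intro measurable_restrict_space2) auto
  then show ?thesis
    by (rule measurable_compose[OF _ borel_measurable_continuous_on_restrict[OF h]])
qed

lemma continuous_f: "continuous_on BB f"
  using deriv by (intro has_derivative_continuous_on)

lemma continuous_gradf: "continuous_on BB gradf"
  using lip by (rule lipschitz_on_continuous_on)

lemma integrable_f:
  assumes "u \<in> borel_measurable P" "\<And>\<omega>. \<omega> \<in> space P \<Longrightarrow> u \<omega> \<in> BB"
  shows "integrable P (\<lambda>\<omega>. f (u \<omega>))"
  using measurable_continuous_in_BB[OF continuous_f assms] assms f_le
  by (intro integrable_const_bound[where B=K]) auto

lemma tangent: "y \<in> BB \<Longrightarrow> z \<in> BB \<Longrightarrow> f z \<ge> f y + gradf y \<bullet> (z - y)"
  by (rule convex_tangent_bound[OF convex_BB deriv lip convex_f])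

lemma jensen:
  assumes u: "u \<in> borel_measurable P" "\<And>\<omega>. \<omega> \<in> space P \<Longrightarrow> u \<omega> \<in> BB" and m: "expectation u \<in> BB"
  shows "f (expectation u) \<le> expectation (\<lambda>\<omega>. f (u \<omega>))"
proof -
  note int = integrable_in_BB[OF u]
  have "f (expectation u) = expectation (\<lambda>\<omega>. f (expectation u) + gradf (expectation u) \<bullet> (u \<omega> - expectation u))"
    using int by (simp add: inner_diff_right prob_space)
  also have "\<dots> \<le> expectation (\<lambda>\<omega>. f (u \<omega>))"
    using int integrable_f[OF u] u m by (intro integral_mono) (auto intro: tangent)
  finally show ?thesis .
qed

lemma norm_slack_le: "y \<in> BB \<Longrightarrow> norm (A *v y - b) \<le> \<bar>B\<bar>"
  using slack_le[of y] by (simp add: norm_vec_def L2_set_def row_inner real_le_lsqrt real_sqrt_le_iff flip: real_sqrt_abs)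

lemma norm_Q_le: "\<omega> \<in> space P \<Longrightarrow> norm (Q t \<omega>) \<le> real t * \<bar>B\<bar>"
proof (induction t)
  case (Suc t)
  have "norm (Q (Suc t) \<omega>) \<le> norm (Q t \<omega> + (A *v x t \<omega> - b))"
    using Suc.prems by (simp add: Q_Suc norm_positive_part_le)
  also have "\<dots> \<le> norm (Q t \<omega>) + norm (A *v x t \<omega> - b)" by (rule norm_triangle_ineq)
  also have "\<dots> \<le> real t * \<bar>B\<bar> + \<bar>B\<bar>" using Suc norm_slack_le[OF x_in] by (intro add_mono) auto
  finally show ?case by (simp add: algebra_simps)
qed (simp add: Q_0)

lemma integrable_Q [simp]: "integrable P (Q t)"
  using norm_Q_le by (intro integrable_const_bound[where B="real t * \<bar>B\<bar>"]) auto

lemma integrable_norm_Q_sq [simp]: "integrable P (\<lambda>\<omega>. (norm (Q t \<omega>))\<^sup>2)"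
  unfolding power2_norm_eq_inner by (rule integrable_inner[OF measurable_Q measurable_Q norm_Q_le norm_Q_le])

lemma measurable_cost: "cost \<in> borel_measurable history_space"
proof -
  have fst_borel: "fst \<in> borel_measurable history_space" and snd: "snd \<in> borel_measurable history_space"
    by (intro measurable_restrict_space1 borel_measurable_continuous_onI continuous_intros)+
  have fst: "fst \<in> history_space \<rightarrow>\<^sub>M restrict_space borel BB"
    by (rule measurable_restrict_space2[OF _ fst_borel]) auto
  have [measurable]: "(\<lambda>z. gradf (fst z)) \<in> borel_measurable history_space"
    by (rule measurable_compose[OF fst borel_measurable_continuous_on_restrict[OF continuous_gradf]])
  have [measurable]: "(\<lambda>z. transpose A *v snd z) \<in> borel_measurable history_space"
    by (rule measurable_compose[OF snd borel_measurable_continuous_onI])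
      (rule matrix_vector_mult_linear_continuous_on)
  show ?thesis unfolding cost_def by measurable
qed

lemma measurable_cost_Z [measurable]: "(\<lambda>\<omega>. cost (Z t \<omega>)) \<in> borel_measurable P"
  by (rule measurable_compose[OF measurable_Z measurable_cost])

lemma cost_bounded: "\<exists>C. \<forall>\<omega>\<in>space P. norm (cost (Z t \<omega>)) \<le> C"
proof (intro exI ballI)
  fix \<omega> assume \<omega>: "\<omega> \<in> space P"
  have "norm (transpose A *v Q t \<omega>) \<le> onorm (\<lambda>q. transpose A *v q) * norm (Q t \<omega>)"
    by (rule onorm[OF matrix_vector_mul_bounded_linear])
  also have "\<dots> \<le> onorm (\<lambda>q. transpose A *v q) * (real t * \<bar>B\<bar>)"
    using norm_Q_le[OF \<omega>] onorm_pos_le[OF matrix_vector_mul_bounded_linear] by (intro mult_left_mono)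
  finally show "norm (cost (Z t \<omega>)) \<le> V * M + onorm (\<lambda>q. transpose A *v q) * (real t * \<bar>B\<bar>)"
    using gradf_le[OF \<gamma>_in[OF \<omega>], of t] V_pos unfolding cost_def
    by (intro norm_triangle_mono) auto
qed

lemma integrable_cost_inner:
  assumes "u \<in> borel_measurable P" "\<And>\<omega>. \<omega> \<in> space P \<Longrightarrow> u \<omega> \<in> BB"
  shows "integrable P (\<lambda>\<omega>. cost (Z t \<omega>) \<bullet> u \<omega>)"
proof -
  obtain C where "\<And>\<omega>. \<omega> \<in> space P \<Longrightarrow> norm (cost (Z t \<omega>)) \<le> C" using cost_bounded by blast
  then show ?thesis using assms BB_norm_le by (intro integrable_inner[where p=C and q=D]) auto
qed

section \<open>Optimality of the decisions against stationary algorithms\<close>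

lemma joint_integral:
  fixes \<phi> :: "real^'m \<Rightarrow> (real^'d) \<times> (real^'n) \<Rightarrow> real"
  assumes \<phi>: "(\<lambda>(s, z). \<phi> s z) \<in> borel_measurable (state_space \<Otimes>\<^sub>M history_space)"
    and int: "integrable P (\<lambda>\<omega>. \<phi> (S t \<omega>) (Z t \<omega>))"
  shows "(\<integral>s. \<integral>z. \<phi> s z \<partial>history_law t \<partial>state_law) = expectation (\<lambda>\<omega>. \<phi> (S t \<omega>) (Z t \<omega>))"
    and "(\<integral>z. \<integral>s. \<phi> s z \<partial>state_law \<partial>history_law t) = expectation (\<lambda>\<omega>. \<phi> (S t \<omega>) (Z t \<omega>))"
    and "integrable (history_law t) (\<lambda>z. \<integral>s. \<phi> s z \<partial>state_law)"
proof -
  interpret s: prob_space state_law by (rule prob_space_state_law)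
  interpret z: prob_space "history_law t" by (rule prob_space_history_law)
  interpret pair_sigma_finite state_law "history_law t" ..
  have SZ: "(\<lambda>\<omega>. (S t \<omega>, Z t \<omega>)) \<in> P \<rightarrow>\<^sub>M state_space \<Otimes>\<^sub>M history_space" by measurable
  have int': "integrable (state_law \<Otimes>\<^sub>M history_law t) (\<lambda>(s, z). \<phi> s z)"
    using int by (simp add: joint_law[symmetric] integrable_distr_eq[OF SZ \<phi>])
  have eq: "integral\<^sup>L (state_law \<Otimes>\<^sub>M history_law t) (\<lambda>(s, z). \<phi> s z) = expectation (\<lambda>\<omega>. \<phi> (S t \<omega>) (Z t \<omega>))"
    by (simp add: joint_law[symmetric] integral_distr[OF SZ \<phi>])
  show "(\<integral>s. \<integral>z. \<phi> s z \<partial>history_law t \<partial>state_law) = expectation (\<lambda>\<omega>. \<phi> (S t \<omega>) (Z t \<omega>))"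
    using integral_fst'[OF int'] eq by simp
  show "(\<integral>z. \<integral>s. \<phi> s z \<partial>state_law \<partial>history_law t) = expectation (\<lambda>\<omega>. \<phi> (S t \<omega>) (Z t \<omega>))"
    using integral_snd[OF int'] eq by simp
  show "integrable (history_law t) (\<lambda>z. \<integral>s. \<phi> s z \<partial>state_law)"
    by (rule integrable_snd[OF int'])
qed

text \<open>
  Let a stationary algorithm draw a seed with the law of the memory before slot \<open>t\<close> and then decide as
  \<open>policy t\<close> would.  By independence of memory and state, its mean decision is \<open>E x_t\<close>.
\<close>

lemma expectation_x_in_region: "expectation (x t) \<in> region"
proof -
  define \<kappa> :: "(real^'m) \<times> (real^'d) \<times> (real^'n) \<Rightarrow> (real^'d) measure"
    where "\<kappa> = (\<lambda>p. return borel ((\<lambda>(s, z). policy t (fst z) (snd z) s) p))"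
  have "\<kappa> \<in> state_space \<Otimes>\<^sub>M history_space \<rightarrow>\<^sub>M prob_algebra borel"
    unfolding \<kappa>_def by (rule measurable_compose[OF policy_measurable measurable_return_prob_space])
  then have \<kappa>: "\<kappa> \<in> state_space \<Otimes>\<^sub>M history_law t \<rightarrow>\<^sub>M prob_algebra borel"
    by (simp add: measurable_cong_sets[OF sets_pair_measure_cong[OF refl sets_history_law] refl])
  have conc: "AE y in \<kappa> (s, z). y \<in> X s" if "s \<in> SS" "z \<in> space (history_law t)" for s z
  proof -
    have "X s \<in> sets borel" using options[OF that(1)] by (intro borel_closed compact_imp_closed) auto
    then show ?thesis using policy_in(1)[OF _ that(1), of z t] that(2) unfolding \<kappa>_def
      by (subst AE_return) auto
  qed
  obtain y where y: "y \<in> stationary_expectations P (S 0) SS X"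
    and y_eq: "\<And>c. c \<bullet> y = (\<integral>s. \<integral>z. \<integral>x. c \<bullet> x \<partial>\<kappa> (s, z) \<partial>history_law t \<partial>state_law)"
    using seeded_kernel[OF prob_space_history_law \<kappa> conc] by blast
  have "c \<bullet> y = c \<bullet> expectation (x t)" for c
  proof -
    have x: "expectation (\<lambda>\<omega>. c \<bullet> policy t (\<gamma> t \<omega>) (Q t \<omega>) (S t \<omega>)) = expectation (\<lambda>\<omega>. c \<bullet> x t \<omega>)"
      by (intro Bochner_Integration.integral_cong) (auto simp: x_eq)
    have int: "integrable P (\<lambda>\<omega>. c \<bullet> policy t (\<gamma> t \<omega>) (Q t \<omega>) (S t \<omega>)) = integrable P (\<lambda>\<omega>. c \<bullet> x t \<omega>)"
      by (intro Bochner_Integration.integrable_cong) (auto simp: x_eq)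
    have "c \<bullet> y = (\<integral>s. \<integral>z. c \<bullet> policy t (fst z) (snd z) s \<partial>history_law t \<partial>state_law)"
      unfolding y_eq \<kappa>_def by (simp add: integral_return)
    also have "\<dots> = expectation (\<lambda>\<omega>. c \<bullet> policy t (fst (Z t \<omega>)) (snd (Z t \<omega>)) (S t \<omega>))"
      using policy_measurable[of t] int
      by (intro joint_integral(1)) (auto simp: case_prod_beta')
    also have "\<dots> = c \<bullet> expectation (x t)" by (simp add: x)
    finally show ?thesis .
  qed
  then have "y = expectation (x t)" using vector_eq_ldot by blast
  then show ?thesis using y closure_subset unfolding closed_region_def by blast
qed

text \<open>
  Condition on the memory, which is possible by independence: its cost vector is then fixed,
  the decision minimizes this linear cost for every state, and \<open>region_lower_bound\<close> applies.
\<close>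

lemma expected_cost_le:
  assumes y: "y \<in> region"
  shows "expectation (\<lambda>\<omega>. cost (Z t \<omega>) \<bullet> x t \<omega>) \<le> expectation (\<lambda>\<omega>. cost (Z t \<omega>) \<bullet> y)"
proof -
  interpret s: prob_space state_law by (rule prob_space_state_law)
  define \<phi> where "\<phi> s z = cost z \<bullet> policy t (fst z) (snd z) s" for s z
  have \<phi>: "(\<lambda>(s, z). \<phi> s z) \<in> borel_measurable (state_space \<Otimes>\<^sub>M history_space)"
    using policy_measurable[of t] measurable_compose[OF measurable_snd measurable_cost]
    unfolding \<phi>_def case_prod_beta' by (intro borel_measurable_inner)
  have \<phi>_x: "\<phi> (S t \<omega>) (Z t \<omega>) = cost (Z t \<omega>) \<bullet> x t \<omega>" if "\<omega> \<in> space P" for \<omega>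
    using that by (simp add: \<phi>_def x_eq)
  have int: "integrable P (\<lambda>\<omega>. \<phi> (S t \<omega>) (Z t \<omega>))"
    by (subst Bochner_Integration.integrable_cong[OF refl \<phi>_x]) (auto intro!: integrable_cost_inner x_in)
  have y_BB: "y \<in> BB" using y region_subset by auto
  have int_y: "integrable P (\<lambda>\<omega>. cost (Z t \<omega>) \<bullet> y)"
    by (rule integrable_cost_inner) (auto simp: y_BB)
  have cost_y: "(\<lambda>z. cost z \<bullet> y) \<in> borel_measurable history_space"
    using measurable_cost by measurable
  have "expectation (\<lambda>\<omega>. cost (Z t \<omega>) \<bullet> x t \<omega>) = expectation (\<lambda>\<omega>. \<phi> (S t \<omega>) (Z t \<omega>))"
    by (intro Bochner_Integration.integral_cong) (auto simp: \<phi>_x)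
  also have "\<dots> = (\<integral>z. \<integral>s. \<phi> s z \<partial>state_law \<partial>history_law t)"
    by (rule joint_integral(2)[OF \<phi> int, symmetric])
  also have "\<dots> \<le> (\<integral>z. cost z \<bullet> y \<partial>history_law t)"
  proof (rule integral_mono)
    show "integrable (history_law t) (\<lambda>z. \<integral>s. \<phi> s z \<partial>state_law)"
      by (rule joint_integral(3)[OF \<phi> int])
    show "integrable (history_law t) (\<lambda>z. cost z \<bullet> y)"
      unfolding history_law_def using int_y cost_y by (simp add: integrable_distr_eq)
    fix z assume "z \<in> space (history_law t)"
    then have z: "z \<in> BB \<times> {0..}" by simp
    show "(\<integral>s. \<phi> s z \<partial>state_law) \<le> cost z \<bullet> y"
    proof (rule region_lower_bound[OF y])
      show "\<phi> s z \<le> cost z \<bullet> x" if "s \<in> SS" "x \<in> X s" for s x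
        using policy_in(3)[OF z that] by (simp add: \<phi>_def)
      have "(\<lambda>s. \<phi> s z) \<in> borel_measurable state_law"
        using measurable_compose[OF _ \<phi>, of "\<lambda>s. (s, z)" state_law] z by simp
      moreover have "\<bar>\<phi> s z\<bar> \<le> norm (cost z) * D" if "s \<in> SS" for s
      proof -
        have "\<bar>\<phi> s z\<bar> \<le> norm (cost z) * norm (policy t (fst z) (snd z) s)"
          unfolding \<phi>_def by (rule Cauchy_Schwarz_ineq2)
        also have "\<dots> \<le> norm (cost z) * D"
          using BB_norm_le[OF policy_in(2)[OF z that]] by (intro mult_left_mono) auto
        finally show ?thesis .
      qed
      ultimately show "integrable state_law (\<lambda>s. \<phi> s z)"
        by (intro s.integrable_const_bound[where B="norm (cost z) * D"]) auto
    qed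
  qed
  also have "\<dots> = expectation (\<lambda>\<omega>. cost (Z t \<omega>) \<bullet> y)"
    unfolding history_law_def by (rule integral_distr[OF measurable_Z cost_y])
  finally show ?thesis .
qed

section \<open>Drift-plus-penalty analysis\<close>

text \<open>
  The second-order terms of one slot: \<open>B\<^sup>2 / 2\<close> from the queues and the rest from the curvature of \<open>f\<close>.
\<close>

definition slot_error :: real where
  "slot_error = B\<^sup>2 / 2 + V * \<eta> * L * D\<^sup>2 / 2"

lemma L_nonneg: "0 \<le> L" using lip by (rule lipschitz_on_nonneg)

lemma D_nonneg: "0 \<le> D" using diam[OF zero_in_BB zero_in_BB] by simp

text \<open>
  Taking positive parts does not increase the norm; expand the square.
\<close>

lemma queue_drift:
  assumes \<omega>: "\<omega> \<in> space P"
  shows "(norm (Q (Suc t) \<omega>))\<^sup>2 \<le> (norm (Q t \<omega>))\<^sup>2 + 2 * (Q t \<omega> \<bullet> (A *v x t \<omega> - b)) + B\<^sup>2"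
proof -
  let ?s = "A *v x t \<omega> - b"
  have "(norm (Q (Suc t) \<omega>))\<^sup>2 \<le> (norm (Q t \<omega> + ?s))\<^sup>2"
    using \<omega> by (simp add: Q_Suc norm_positive_part_le power_mono)
  also have "\<dots> = (norm (Q t \<omega>))\<^sup>2 + 2 * (Q t \<omega> \<bullet> ?s) + (norm ?s)\<^sup>2"
    by (simp add: power2_norm_eq_inner inner_add_left inner_add_right inner_commute)
  also have "(norm ?s)\<^sup>2 \<le> B\<^sup>2"
    using power_mono[OF norm_slack_le[OF x_in[OF \<omega>, of t]] norm_ge_zero, where n=2] by simp
  finally show ?thesis by simp
qed

text \<open>
  Quadratic upper bound for the step \<open>\<eta> (x_t - \<gamma>_{t-1})\<close>.  The factor \<open>V / \<eta>\<close> turns the first-order term into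
  the term with weight \<open>V\<close> that the decision minimizes.
\<close>

lemma objective_descent:
  assumes \<omega>: "\<omega> \<in> space P"
  shows "V / \<eta> * (f (\<gamma> (Suc t) \<omega>) - f (\<gamma> t \<omega>))
    \<le> V * (gradf (\<gamma> t \<omega>) \<bullet> (x t \<omega> - \<gamma> t \<omega>)) + V * \<eta> * L * D\<^sup>2 / 2"
proof -
  let ?d = "x t \<omega> - \<gamma> t \<omega>"
  have step: "\<gamma> (Suc t) \<omega> - \<gamma> t \<omega> = \<eta> *\<^sub>R ?d" using \<omega> by (simp add: \<gamma>_Suc algebra_simps)
  have "f (\<gamma> (Suc t) \<omega>) - f (\<gamma> t \<omega>) \<le> \<eta> * (gradf (\<gamma> t \<omega>) \<bullet> ?d) + L / 2 * (\<eta> * norm ?d)\<^sup>2"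
    using smooth_upper_bound[OF convex_BB deriv lip \<gamma>_in[OF \<omega>, of t] \<gamma>_in[OF \<omega>, of "Suc t"]] \<eta>_pos
    unfolding step by simp
  also have "(\<eta> * norm ?d)\<^sup>2 \<le> (\<eta> * D)\<^sup>2"
    using diam[OF x_in[OF \<omega>] \<gamma>_in[OF \<omega>]] \<eta>_pos by (intro power_mono mult_left_mono) auto
  finally have "f (\<gamma> (Suc t) \<omega>) - f (\<gamma> t \<omega>) \<le> \<eta> * (gradf (\<gamma> t \<omega>) \<bullet> ?d) + L / 2 * (\<eta> * D)\<^sup>2"
    using L_nonneg by (simp add: mult_left_mono)
  then have "V / \<eta> * (f (\<gamma> (Suc t) \<omega>) - f (\<gamma> t \<omega>)) \<le> V / \<eta> * (\<eta> * (gradf (\<gamma> t \<omega>) \<bullet> ?d) + L / 2 * (\<eta> * D)\<^sup>2)"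
    using V_pos \<eta>_pos by (intro mult_left_mono) auto
  also have "\<dots> = V * (gradf (\<gamma> t \<omega>) \<bullet> ?d) + V * \<eta> * L * D\<^sup>2 / 2"
    using \<eta>_pos by (simp add: field_simps power2_eq_square)
  finally show ?thesis .
qed

text \<open>
  Add the two preceding bounds and replace the decision \<open>x_t\<close> by the point \<open>y\<close> of the region, which
  can only increase the expected cost.  Convexity of \<open>f\<close> bounds the gradient term at \<open>y\<close>, and the queue
  term at \<open>y\<close> is nonpositive because \<open>y\<close> is feasible and queues are nonnegative.
\<close>

lemma expected_step:
  assumes y: "y \<in> region" and feasible: "A *v y \<le> b"
  shows "V / \<eta> * (expectation (\<lambda>\<omega>. f (\<gamma> (Suc t) \<omega>)) - expectation (\<lambda>\<omega>. f (\<gamma> t \<omega>)))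
      + (expectation (\<lambda>\<omega>. (norm (Q (Suc t) \<omega>))\<^sup>2) - expectation (\<lambda>\<omega>. (norm (Q t \<omega>))\<^sup>2)) / 2
    \<le> V * (f y - expectation (\<lambda>\<omega>. f (\<gamma> t \<omega>))) + slot_error"
proof -
  have y_BB: "y \<in> BB" using y region_subset by auto
  have int_f: "integrable P (\<lambda>\<omega>. f (\<gamma> t \<omega>))" for t
    by (rule integrable_f[OF measurable_\<gamma> \<gamma>_in])
  have int_x: "integrable P (\<lambda>\<omega>. cost (Z t \<omega>) \<bullet> x t \<omega>)"
    and int_y: "integrable P (\<lambda>\<omega>. cost (Z t \<omega>) \<bullet> y)"
    and int_\<gamma>: "integrable P (\<lambda>\<omega>. cost (Z t \<omega>) \<bullet> \<gamma> t \<omega>)"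
    by (auto intro!: integrable_cost_inner x_in \<gamma>_in y_BB)
  have int_Q\<gamma>: "integrable P (\<lambda>\<omega>. Q t \<omega> \<bullet> (A *v \<gamma> t \<omega> - b))"
  proof (rule integrable_inner[OF measurable_Q _ norm_Q_le norm_slack_le[OF \<gamma>_in]])
    show "(\<lambda>\<omega>. A *v \<gamma> t \<omega> - b) \<in> borel_measurable P"
      by (rule measurable_compose[OF measurable_\<gamma> borel_measurable_continuous_onI])
        (intro continuous_intros matrix_vector_mult_linear_continuous_on)
  qed
  \<comment> \<open>The part of the drift-plus-penalty expression that the decision does not affect.\<close>
  define r where "r \<omega> = Q t \<omega> \<bullet> (A *v \<gamma> t \<omega> - b) - cost (Z t \<omega>) \<bullet> \<gamma> t \<omega>" for \<omega>
  have int_r: "integrable P r" unfolding r_def using int_Q\<gamma> int_\<gamma> by simp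
  have cost_split: "cost (Z t \<omega>) \<bullet> z + r \<omega> = V * (gradf (\<gamma> t \<omega>) \<bullet> (z - \<gamma> t \<omega>)) + Q t \<omega> \<bullet> (A *v z - b)" for z \<omega>
    by (simp add: r_def cost_inner inner_diff_right algebra_simps)
  have "V / \<eta> * (expectation (\<lambda>\<omega>. f (\<gamma> (Suc t) \<omega>)) - expectation (\<lambda>\<omega>. f (\<gamma> t \<omega>)))
      + (expectation (\<lambda>\<omega>. (norm (Q (Suc t) \<omega>))\<^sup>2) - expectation (\<lambda>\<omega>. (norm (Q t \<omega>))\<^sup>2)) / 2
    = expectation (\<lambda>\<omega>. V / \<eta> * (f (\<gamma> (Suc t) \<omega>) - f (\<gamma> t \<omega>)) + ((norm (Q (Suc t) \<omega>))\<^sup>2 - (norm (Q t \<omega>))\<^sup>2) / 2)"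
    using int_f by simp
  also have "\<dots> \<le> expectation (\<lambda>\<omega>. cost (Z t \<omega>) \<bullet> x t \<omega> + r \<omega> + slot_error)"
  proof (rule integral_mono)
    fix \<omega> assume \<omega>: "\<omega> \<in> space P"
    have drift: "((norm (Q (Suc t) \<omega>))\<^sup>2 - (norm (Q t \<omega>))\<^sup>2) / 2 \<le> Q t \<omega> \<bullet> (A *v x t \<omega> - b) + B\<^sup>2 / 2"
      using queue_drift[OF \<omega>, of t] by simp
    show "V / \<eta> * (f (\<gamma> (Suc t) \<omega>) - f (\<gamma> t \<omega>)) + ((norm (Q (Suc t) \<omega>))\<^sup>2 - (norm (Q t \<omega>))\<^sup>2) / 2
        \<le> cost (Z t \<omega>) \<bullet> x t \<omega> + r \<omega> + slot_error"
      using add_mono[OF objective_descent[OF \<omega>, of t] drift]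
      unfolding cost_split slot_error_def by simp
  qed (use int_f int_x int_r in auto)
  also have "\<dots> = expectation (\<lambda>\<omega>. cost (Z t \<omega>) \<bullet> x t \<omega>) + expectation r + slot_error"
    using int_x int_r by (simp add: prob_space)
  also have "\<dots> \<le> expectation (\<lambda>\<omega>. cost (Z t \<omega>) \<bullet> y) + expectation r + slot_error"
    using expected_cost_le[OF y, of t] by simp
  also have "\<dots> = expectation (\<lambda>\<omega>. cost (Z t \<omega>) \<bullet> y + r \<omega>) + slot_error"
    using int_y int_r by simp
  also have "expectation (\<lambda>\<omega>. cost (Z t \<omega>) \<bullet> y + r \<omega>) \<le> expectation (\<lambda>\<omega>. V * (f y - f (\<gamma> t \<omega>)))"
  proof (rule integral_mono)
    fix \<omega> assume \<omega>: "\<omega> \<in> space P"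
    have "Q t \<omega> \<bullet> (b - A *v y) \<ge> 0"
      using feasible Q_nonneg[OF \<omega>] by (intro inner_nonneg_vec) (auto simp: less_eq_vec_def)
    moreover have "V * (gradf (\<gamma> t \<omega>) \<bullet> (y - \<gamma> t \<omega>)) \<le> V * (f y - f (\<gamma> t \<omega>))"
      using tangent[OF \<gamma>_in[OF \<omega>] y_BB, of t] V_pos by (intro mult_left_mono) auto
    ultimately show "cost (Z t \<omega>) \<bullet> y + r \<omega> \<le> V * (f y - f (\<gamma> t \<omega>))"
      unfolding cost_split by (simp add: inner_diff_right)
  qed (use int_f int_y int_r in auto)
  also have "\<dots> = V * (f y - expectation (\<lambda>\<omega>. f (\<gamma> t \<omega>)))"
    using int_f by (simp add: prob_space)
  finally show ?thesis by simp
qed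

lemma expected_f_bound: "\<bar>expectation (\<lambda>\<omega>. f (\<gamma> t \<omega>))\<bar> \<le> K"
proof -
  have int: "integrable P (\<lambda>\<omega>. f (\<gamma> t \<omega>))" by (rule integrable_f[OF measurable_\<gamma> \<gamma>_in])
  have "- K \<le> f (\<gamma> t \<omega>) \<and> f (\<gamma> t \<omega>) \<le> K" if "\<omega> \<in> space P" for \<omega>
    using f_le[OF \<gamma>_in[OF that, of t]] by (auto simp: abs_le_iff)
  then have "expectation (\<lambda>\<omega>. f (\<gamma> t \<omega>)) \<le> K" "- K \<le> expectation (\<lambda>\<omega>. f (\<gamma> t \<omega>))"
    using int by (auto intro!: integral_le_const integral_ge_const AE_I2)
  then show ?thesis by simp
qed

text \<open>
  Summing over the slots telescopes; the queues start at \<open>0\<close>, and the total change of \<open>f\<close> is at most \<open>2 K\<close>.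
\<close>

lemma accumulated_drift:
  assumes y: "y \<in> region" "A *v y \<le> b"
  shows "V * (\<Sum>t<T. expectation (\<lambda>\<omega>. f (\<gamma> t \<omega>)) - f y) + expectation (\<lambda>\<omega>. (norm (Q T \<omega>))\<^sup>2) / 2
    \<le> T * slot_error + 2 * K * V / \<eta>"
proof -
  define F where "F t = expectation (\<lambda>\<omega>. f (\<gamma> t \<omega>))" for t
  have Q0: "expectation (\<lambda>\<omega>. (norm (Q 0 \<omega>))\<^sup>2) = 0"
    by (subst Bochner_Integration.integral_cong[OF refl, of _ _ "\<lambda>_. 0"]) (auto simp: Q_0)
  have "V / \<eta> * (F T - F 0) + V * (\<Sum>t<T. F t - f y) + expectation (\<lambda>\<omega>. (norm (Q T \<omega>))\<^sup>2) / 2 \<le> T * slot_error"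
  proof (induction T)
    case (Suc T)
    then show ?case
      using expected_step[OF y, of T] unfolding F_def by (simp add: algebra_simps diff_divide_distrib)
  qed (simp add: Q0)
  moreover have "V / \<eta> * (F 0 - F T) \<le> V / \<eta> * (2 * K)"
    using expected_f_bound[of 0] expected_f_bound[of T] V_pos \<eta>_pos unfolding F_def
    by (intro mult_left_mono) auto
  ultimately show ?thesis unfolding F_def by (simp add: algebra_simps)
qed

section \<open>Time averages\<close>

lemma sum_steps: "\<omega> \<in> space P \<Longrightarrow> (\<Sum>t<T. x t \<omega> - \<gamma> t \<omega>) = (1 / \<eta>) *\<^sub>R (\<gamma> T \<omega> - \<gamma> 0 \<omega>)"
proof -
  assume \<omega>: "\<omega> \<in> space P"
  have "x t \<omega> - \<gamma> t \<omega> = (1 / \<eta>) *\<^sub>R (\<gamma> (Suc t) \<omega> - \<gamma> t \<omega>)" for t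
    using \<omega> \<eta>_pos by (simp add: \<gamma>_Suc algebra_simps)
  then show ?thesis
    by (simp add: scaleR_sum_right[symmetric] sum_lessThan_telescope[of "\<lambda>t. \<gamma> t \<omega>"])
qed

text \<open>
  A queue is never smaller than the sum of its increments.
\<close>

lemma sum_slack_le_Q: "\<omega> \<in> space P \<Longrightarrow> (\<Sum>t<T. A *v x t \<omega> - b) \<le> Q T \<omega>"
proof (induction T)
  case (Suc T)
  have "(\<Sum>t<Suc T. A *v x t \<omega> - b) \<le> Q T \<omega> + (A *v x T \<omega> - b)"
    using Suc by simp
  also have "\<dots> \<le> Q (Suc T) \<omega>"
    using positive_part_ge[of "Q T \<omega> + (A *v x T \<omega> - b)"] Suc.prems by (simp add: Q_Suc less_eq_vec_def)
  finally show ?case .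
qed (simp add: Q_0)

lemma norm_travel: "\<omega> \<in> space P \<Longrightarrow> norm ((1 / \<eta>) *\<^sub>R (\<gamma> T \<omega> - \<gamma> 0 \<omega>)) \<le> D / \<eta>"
  using diam[OF \<gamma>_in \<gamma>_in, of \<omega> \<omega> T 0] \<eta>_pos by (simp add: divide_right_mono)

lemma measurable_time_avg [measurable]: "time_avg x T \<in> borel_measurable P"
  unfolding time_avg_def by measurable

lemma time_avg_in: "0 < T \<Longrightarrow> \<omega> \<in> space P \<Longrightarrow> time_avg x T \<omega> \<in> BB"
  unfolding time_avg_def by (rule average_in_convex[OF convex_BB]) (auto simp: x_in)

lemma expectation_time_avg:
  "expectation (time_avg x T) = (1 / real T) *\<^sub>R (\<Sum>t<T. expectation (x t))"
  unfolding time_avg_def by simp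

lemma expectation_time_avg_in_region: "0 < T \<Longrightarrow> expectation (time_avg x T) \<in> region"
  unfolding expectation_time_avg by (rule average_in_convex[OF convex_region _ expectation_x_in_region])

lemma expectation_\<gamma>_in_region: "expectation (\<gamma> t) \<in> region"
proof (induction t)
  case 0
  have "expectation (\<gamma> 0) = expectation (\<lambda>_. 0)"
    by (intro Bochner_Integration.integral_cong) (auto simp: \<gamma>_0)
  then show ?case using zero_in_region by simp
next
  case (Suc t)
  have "expectation (\<gamma> (Suc t)) = expectation (\<lambda>\<omega>. (1 - \<eta>) *\<^sub>R \<gamma> t \<omega> + \<eta> *\<^sub>R x t \<omega>)"
    by (intro Bochner_Integration.integral_cong) (auto simp: \<gamma>_Suc)
  also have "\<dots> = (1 - \<eta>) *\<^sub>R expectation (\<gamma> t) + \<eta> *\<^sub>R expectation (x t)" by simp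
  finally show ?case
    using convexD_alt[OF convex_region Suc expectation_x_in_region] \<eta>_pos \<eta>_le by simp
qed

text \<open>
  The two averages are close by \<open>sum_steps\<close>.  Bounding \<open>f\<close> at the average of \<open>x\<close> through the tangent there
  brings in the gradient bound \<open>M\<close>, and convexity splits \<open>f\<close> at the average of \<open>\<gamma>\<close>.
\<close>

lemma f_time_avg_le:
  assumes T: "0 < T" and \<omega>: "\<omega> \<in> space P"
  shows "f (time_avg x T \<omega>) \<le> (1 / real T) * (\<Sum>t<T. f (\<gamma> t \<omega>)) + M * D / (\<eta> * real T)"
proof -
  let ?x = "time_avg x T \<omega>" and ?\<gamma> = "time_avg \<gamma> T \<omega>"
  have x: "?x \<in> BB" and \<gamma>: "?\<gamma> \<in> BB"
    unfolding time_avg_def by (rule average_in_convex[OF convex_BB T], simp add: x_in \<gamma>_in \<omega>)+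
  have "?x - ?\<gamma> = (1 / real T) *\<^sub>R (\<Sum>t<T. x t \<omega> - \<gamma> t \<omega>)"
    by (simp add: time_avg_def sum_subtractf scaleR_diff_right)
  then have "norm (?x - ?\<gamma>) \<le> (D / \<eta>) / real T"
    using divide_right_mono[OF norm_travel[OF \<omega>, of T], of "real T"]
    unfolding sum_steps[OF \<omega>] norm_scaleR[of "1 / real T"] by (simp add: abs_mult mult.commute)
  have "f ?x \<le> f ?\<gamma> + gradf ?x \<bullet> (?x - ?\<gamma>)"
    using tangent[OF x \<gamma>] by (simp add: inner_diff_right)
  also have "gradf ?x \<bullet> (?x - ?\<gamma>) \<le> norm (gradf ?x) * norm (?x - ?\<gamma>)" by (rule norm_cauchy_schwarz)
  also have "\<dots> \<le> M * ((D / \<eta>) / real T)"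
    using gradf_le[OF x] \<open>norm (?x - ?\<gamma>) \<le> _\<close> order_trans[OF norm_ge_zero gradf_le[OF x]]
    by (intro mult_mono) auto
  also have "f ?\<gamma> \<le> (\<Sum>t<T. (1 / real T) * f (\<gamma> t \<omega>))"
    unfolding time_avg_def scaleR_sum_right
    using T \<omega> by (intro convex_on_sum[OF _ _ convex_f]) (auto simp: \<gamma>_in lessThan_empty_iff)
  finally show ?thesis by (simp add: sum_distrib_left)
qed

text \<open>
  In \<open>accumulated_drift\<close> the second moment of the queues is nonnegative and can be dropped.
\<close>

lemma expected_objective_bound:
  assumes y: "y \<in> region" "A *v y \<le> b" and T: "0 < T"
  shows "expectation (\<lambda>\<omega>. f (time_avg x T \<omega>))
    \<le> f y + slot_error / V + 2 * K / (\<eta> * real T) + M * D / (\<eta> * real T)"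
proof -
  have int: "integrable P (\<lambda>\<omega>. f (\<gamma> t \<omega>))" for t
    by (rule integrable_f[OF measurable_\<gamma> \<gamma>_in])
  have "expectation (\<lambda>\<omega>. f (time_avg x T \<omega>))
      \<le> expectation (\<lambda>\<omega>. (1 / real T) * (\<Sum>t<T. f (\<gamma> t \<omega>)) + M * D / (\<eta> * real T))"
    using f_time_avg_le[OF T] int integrable_f[OF measurable_time_avg time_avg_in[OF T]]
    by (intro integral_mono) auto
  also have "\<dots> = (1 / real T) * (\<Sum>t<T. expectation (\<lambda>\<omega>. f (\<gamma> t \<omega>))) + M * D / (\<eta> * real T)"
    using int by (simp add: prob_space)
  also have "(1 / real T) * (\<Sum>t<T. expectation (\<lambda>\<omega>. f (\<gamma> t \<omega>))) \<le> f y + slot_error / V + 2 * K / (\<eta> * real T)"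
  proof -
    have "0 \<le> expectation (\<lambda>\<omega>. (norm (Q T \<omega>))\<^sup>2)" by simp
    then have "V * (\<Sum>t<T. expectation (\<lambda>\<omega>. f (\<gamma> t \<omega>)) - f y) \<le> T * slot_error + 2 * K * V / \<eta>"
      using accumulated_drift[OF y, of T] by linarith
    then show ?thesis
      using T V_pos \<eta>_pos by (simp add: sum_subtractf field_simps)
  qed
  finally show ?thesis by simp
qed

text \<open>
  The slacks of the points \<open>\<gamma> t\<close> differ in total from those of the decisions by a telescoping term,
  and the latter are dominated by the queues.
\<close>

lemma multiplier_slack_le:
  assumes lam: "0 \<le> lam" and \<omega>: "\<omega> \<in> space P"
  shows "lam \<bullet> (\<Sum>t<T. A *v \<gamma> t \<omega> - b) \<le> norm lam * norm (Q T \<omega>) + norm (transpose A *v lam) * D / \<eta>"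
proof -
  let ?d = "(1 / \<eta>) *\<^sub>R (\<gamma> T \<omega> - \<gamma> 0 \<omega>)"
  have "(\<Sum>t<T. A *v \<gamma> t \<omega> - b) = (\<Sum>t<T. A *v x t \<omega> - b) - A *v ?d"
    unfolding sum_steps[OF \<omega>, symmetric]
    by (simp add: matrix_vector_mult_diff_distrib sum_subtractf linear_sum[OF matrix_vector_mul_linear])
  then have "lam \<bullet> (\<Sum>t<T. A *v \<gamma> t \<omega> - b)
      = lam \<bullet> (\<Sum>t<T. A *v x t \<omega> - b) - (transpose A *v lam) \<bullet> ?d"
    unfolding transpose_inner by (simp only: inner_diff_right)
  moreover have "lam \<bullet> (\<Sum>t<T. A *v x t \<omega> - b) \<le> lam \<bullet> Q T \<omega>"
    using inner_nonneg_vec[OF lam, of "Q T \<omega> - (\<Sum>t<T. A *v x t \<omega> - b)"] sum_slack_le_Q[OF \<omega>, of T]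
    by (simp add: inner_diff_right)
  moreover have "lam \<bullet> Q T \<omega> \<le> norm lam * norm (Q T \<omega>)" by (rule norm_cauchy_schwarz)
  moreover have "\<bar>(transpose A *v lam) \<bullet> ?d\<bar> \<le> norm (transpose A *v lam) * norm ?d"
    by (rule Cauchy_Schwarz_ineq2)
  moreover have "norm (transpose A *v lam) * norm ?d \<le> norm (transpose A *v lam) * (D / \<eta>)"
    by (intro mult_left_mono norm_travel[OF \<omega>]) simp
  ultimately show ?thesis unfolding times_divide_eq_right by linarith
qed

text \<open>
  The multiplier inequality is applied at \<open>E \<gamma> t\<close>, which lies in the region although \<open>\<gamma> t\<close> itself need
  not; Jensen's inequality then bounds \<open>f y - E f(\<gamma> t)\<close> by the weighted slack of \<open>E \<gamma> t\<close>.
\<close>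

lemma expected_queue_bound:
  assumes y: "y \<in> region" "A *v y \<le> b" and lam: "0 \<le> lam"
    and multiplier: "\<And>z. z \<in> region \<Longrightarrow> f z + lam \<bullet> (A *v z - b) \<ge> f y"
  shows "(expectation (\<lambda>\<omega>. norm (Q T \<omega>)))\<^sup>2
    \<le> 2 * (V * norm lam) * expectation (\<lambda>\<omega>. norm (Q T \<omega>))
      + (2 * V / \<eta> * norm (transpose A *v lam) * D + 4 * K * V / \<eta> + 2 * real T * slot_error)"
proof -
  define m where "m = expectation (\<lambda>\<omega>. norm (Q T \<omega>))"
  have int_Q: "integrable P (\<lambda>\<omega>. norm (Q T \<omega>))" by simp
  \<comment> \<open>The first moment is bounded by the second because the variance is nonnegative.\<close>
  have "0 \<le> expectation (\<lambda>\<omega>. (norm (Q T \<omega>) - m)\<^sup>2)" by simp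
  also have "\<dots> = expectation (\<lambda>\<omega>. (norm (Q T \<omega>))\<^sup>2 - 2 * m * norm (Q T \<omega>) + m\<^sup>2)"
    by (simp add: power2_diff algebra_simps)
  also have "\<dots> = expectation (\<lambda>\<omega>. (norm (Q T \<omega>))\<^sup>2) - 2 * m * m + m\<^sup>2"
    using int_Q by (simp add: prob_space m_def[symmetric])
  also have "\<dots> = expectation (\<lambda>\<omega>. (norm (Q T \<omega>))\<^sup>2) - m\<^sup>2"
    by (simp add: power2_eq_square)
  finally have second_moment: "m\<^sup>2 \<le> expectation (\<lambda>\<omega>. (norm (Q T \<omega>))\<^sup>2)" by simp
  have lower: "f y - expectation (\<lambda>\<omega>. f (\<gamma> t \<omega>)) \<le> expectation (\<lambda>\<omega>. lam \<bullet> (A *v \<gamma> t \<omega> - b))" for t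
  proof -
    have "f (expectation (\<gamma> t)) \<le> expectation (\<lambda>\<omega>. f (\<gamma> t \<omega>))"
      using expectation_\<gamma>_in_region[of t] region_subset by (intro jensen \<gamma>_in) auto
    moreover have "expectation (\<lambda>\<omega>. lam \<bullet> (A *v \<gamma> t \<omega> - b)) = lam \<bullet> (A *v expectation (\<gamma> t) - b)"
      by (simp add: inner_diff_right transpose_inner[symmetric] prob_space del: transpose_matrix_vector)
    ultimately show ?thesis using multiplier[OF expectation_\<gamma>_in_region[of t]] by simp
  qed
  have int_slack: "integrable P (\<lambda>\<omega>. lam \<bullet> (A *v \<gamma> t \<omega> - b))" for t
    by (simp add: inner_diff_right transpose_inner[symmetric] del: transpose_matrix_vector)
  have "(\<Sum>t<T. f y - expectation (\<lambda>\<omega>. f (\<gamma> t \<omega>))) \<le> (\<Sum>t<T. expectation (\<lambda>\<omega>. lam \<bullet> (A *v \<gamma> t \<omega> - b)))"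
    by (intro sum_mono lower)
  also have "\<dots> = expectation (\<lambda>\<omega>. lam \<bullet> (\<Sum>t<T. A *v \<gamma> t \<omega> - b))"
    using int_slack by (simp add: inner_sum_right)
  also have "\<dots> \<le> expectation (\<lambda>\<omega>. norm lam * norm (Q T \<omega>) + norm (transpose A *v lam) * D / \<eta>)"
    using multiplier_slack_le[OF lam] int_slack int_Q
    by (intro integral_mono) (auto simp: inner_sum_right)
  also have "\<dots> = norm lam * m + norm (transpose A *v lam) * D / \<eta>"
    using int_Q by (simp add: prob_space m_def)
  finally have "V * (\<Sum>t<T. f y - expectation (\<lambda>\<omega>. f (\<gamma> t \<omega>))) \<le> V * (norm lam * m + norm (transpose A *v lam) * D / \<eta>)"
    using V_pos by (intro mult_left_mono) auto
  then have multiplier_sum: "- (V * (\<Sum>t<T. expectation (\<lambda>\<omega>. f (\<gamma> t \<omega>)) - f y)) \<le> V * (norm lam * m + norm (transpose A *v lam) * D / \<eta>)"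
    by (simp add: sum_subtractf algebra_simps)
  have "expectation (\<lambda>\<omega>. (norm (Q T \<omega>))\<^sup>2) / 2
      \<le> V * (norm lam * m + norm (transpose A *v lam) * D / \<eta>) + (T * slot_error + 2 * K * V / \<eta>)"
    using multiplier_sum accumulated_drift[OF y, of T] by linarith
  with second_moment show ?thesis unfolding m_def by (simp add: algebra_simps)
qed

lemma violation_le_queue:
  assumes T: "0 < T"
  shows "A $ i \<bullet> expectation (time_avg x T) - b $ i \<le> expectation (\<lambda>\<omega>. norm (Q T \<omega>)) / real T"
proof -
  have int: "integrable P (time_avg x T)" by (rule integrable_in_BB[OF measurable_time_avg time_avg_in[OF T]])
  have "real T * (A $ i \<bullet> expectation (time_avg x T) - b $ i)
      = expectation (\<lambda>\<omega>. real T * (A $ i \<bullet> time_avg x T \<omega> - b $ i))"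
    using int by (simp add: prob_space)
  also have "\<dots> \<le> expectation (\<lambda>\<omega>. norm (Q T \<omega>))"
  proof (rule integral_mono)
    fix \<omega> assume \<omega>: "\<omega> \<in> space P"
    have "real T * (A $ i \<bullet> time_avg x T \<omega> - b $ i) = (\<Sum>t<T. A $ i \<bullet> x t \<omega> - b $ i)"
      using T by (simp add: time_avg_def inner_sum_right sum_subtractf right_diff_distrib)
    also have "\<dots> = (\<Sum>t<T. A *v x t \<omega> - b) $ i" by (simp add: row_inner)
    also have "\<dots> \<le> Q T \<omega> $ i" using sum_slack_le_Q[OF \<omega>, of T] by (simp add: less_eq_vec_def)
    also have "\<dots> \<le> norm (Q T \<omega>)" using component_le_norm_cart[of "Q T \<omega>" i] by simp
    finally show "real T * (A $ i \<bullet> time_avg x T \<omega> - b $ i) \<le> norm (Q T \<omega>)" .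
  qed (use int in auto)
  finally show ?thesis using T by (simp add: field_simps)
qed

end

section \<open>Performance with the parameters tied to the horizon\<close>

theorem theorem3p2:
  fixes P :: "'w measure"
    and S :: "nat \<Rightarrow> 'w \<Rightarrow> real^'m"
    and SS :: "(real^'m) set"
    and X :: "real^'m \<Rightarrow> (real^'d) set"
    and BB :: "(real^'d) set"
    and f :: "real^'d \<Rightarrow> real"
    and gradf :: "real^'d \<Rightarrow> real^'d"
    and A :: "real^'d^'n"
    and b lam :: "real^'n"
    and \<gamma>s :: "real^'d"
    and K M D B L :: real
    and T :: nat
    and x \<gamma> :: "nat \<Rightarrow> 'w \<Rightarrow> real^'d"
    and Q :: "nat \<Rightarrow> 'w \<Rightarrow> real^'n"
  assumes "prob_space P"
    and "iid_states P S SS"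
    and "compact BB" and "convex BB"
    and "\<And>s. s \<in> SS \<Longrightarrow> compact (X s) \<and> X s \<noteq> {} \<and> X s \<subseteq> BB"
    and "0 \<in> closed_region P S SS X"
    and "\<And>y. y \<in> BB \<Longrightarrow> (f has_derivative (\<lambda>h. gradf y \<bullet> h)) (at y within BB)"
    and "L-lipschitz_on BB gradf"
    and "\<And>y. y \<in> BB \<Longrightarrow> norm (gradf y) \<le> M"
    and "\<And>y. y \<in> BB \<Longrightarrow> \<bar>f y\<bar> \<le> K"
    and "\<And>y. y \<in> BB \<Longrightarrow> (\<Sum>i\<in>UNIV. \<bar>A $ i \<bullet> y - b $ i\<bar>\<^sup>2) \<le> B\<^sup>2"
    and "\<And>y z. y \<in> BB \<Longrightarrow> z \<in> BB \<Longrightarrow> norm (y - z) \<le> D"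
    and "convex_on BB f"
    and "is_solution f (closed_region P S SS X) A b \<gamma>s"
    and "0 \<le> lam"
    and "\<And>y. y \<in> closed_region P S SS X \<Longrightarrow> f y + lam \<bullet> (A *v y - b) \<ge> f \<gamma>s"
    and "T > 1"
    and "algorithm_run P S SS X BB gradf A b (sqrt (real T)) (1 / sqrt (real T)) x \<gamma> Q"
  shows "(\<integral>\<omega>. f (time_avg x T \<omega>) \<partial>P)
           \<le> f \<gamma>s + (2 * K + M * D + B\<^sup>2 / 2 + L * D\<^sup>2 / 2) * (1 / sqrt (real T))
       \<and> (\<forall>i. A $ i \<bullet> (\<integral>\<omega>. time_avg x T \<omega> \<partial>P) - b $ i
           \<le> 2 * norm lam / sqrt (real T)
             + sqrt ((2 * norm (transpose A *v lam) * D + 4 * K + B\<^sup>2 + L * D\<^sup>2) / real T))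
       \<and> f (\<integral>\<omega>. time_avg x T \<omega> \<partial>P)
           \<le> f \<gamma>s + (2 * K + M * D + B\<^sup>2 / 2 + L * D\<^sup>2 / 2) * (1 / sqrt (real T))
       \<and> (\<forall>\<epsilon>. 0 < \<epsilon> \<and> \<epsilon> \<le> 1 \<and>
             real T \<ge> convergence_const K M D B L (norm lam) (norm (transpose A *v lam)) / \<epsilon>\<^sup>2
           \<longrightarrow> near_optimal f (closed_region P S SS X) A b \<gamma>s \<epsilon> (\<integral>\<omega>. time_avg x T \<omega> \<partial>P))"
proof -
  \<comment> \<open>With \<open>V = r\<close> and \<open>\<eta> = 1 / r\<close> the relevant products are \<open>V \<eta> = 1\<close>, \<open>\<eta> T = r\<close> and \<open>V / \<eta> = T\<close>.\<close>
  define r where "r = sqrt (real T)"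
  have T: "0 < T" and r: "1 < r" and r_sq: "r * r = real T" "r\<^sup>2 = real T"
    using assms(17) by (simp_all add: r_def)
  interpret prob_space P by (rule assms(1))
  interpret frank_wolfe_run P S SS X BB f gradf A b K M D B L r "1 / r" x \<gamma> Q
    using assms(2-13,18) r by unfold_locales (auto simp: r_def)
  have sol: "\<gamma>s \<in> region" "A *v \<gamma>s \<le> b"
    using assms(14) by (auto simp: is_solution_def is_arg_min_def)
  define c1 where "c1 = 2 * K + M * D + B\<^sup>2 / 2 + L * D\<^sup>2 / 2"
  define c2 where "c2 = 2 * norm (transpose A *v lam) * D + 4 * K + B\<^sup>2 + L * D\<^sup>2"
  have slot: "slot_error = B\<^sup>2 / 2 + L * D\<^sup>2 / 2"
    using r by (simp add: slot_error_def)
  have "K \<ge> 0" using f_le[OF zero_in_BB] by linarith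
  have c2: "0 \<le> c2"
    unfolding c2_def using \<open>K \<ge> 0\<close> D_nonneg L_nonneg by (intro add_nonneg_nonneg mult_nonneg_nonneg) auto
  have objective: "expectation (\<lambda>\<omega>. f (time_avg x T \<omega>)) \<le> f \<gamma>s + c1 * (1 / r)"
    using expected_objective_bound[OF sol T] r
    by (simp add: slot c1_def r_sq(1)[symmetric] add_divide_distrib)
  have violation: "A $ i \<bullet> expectation (time_avg x T) - b $ i \<le> 2 * norm lam / r + sqrt (c2 / real T)" for i
  proof -
    define m where "m = expectation (\<lambda>\<omega>. norm (Q T \<omega>))"
    have "m\<^sup>2 \<le> 2 * (r * norm lam) * m + real T * c2"
      using expected_queue_bound[OF sol assms(15) assms(16), of T] r
      by (simp add: m_def slot c2_def r_sq(1)[symmetric] algebra_simps)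
    then have "m \<le> 2 * (r * norm lam) + sqrt (real T * c2)"
      using c2 r by (intro quadratic_bound_root) auto
    also have "sqrt (real T * c2) = r * sqrt c2"
      by (simp add: real_sqrt_mult r_def)
    finally have "m / real T \<le> (2 * (r * norm lam) + r * sqrt c2) / real T"
      by (simp add: divide_right_mono)
    also have "\<dots> = 2 * norm lam / r + sqrt (c2 / real T)"
      using r unfolding real_sqrt_divide r_def[symmetric] r_sq(1)[symmetric] by (simp add: field_simps)
    finally show ?thesis
      using violation_le_queue[OF T, of i] unfolding m_def by linarith
  qed
  have avg_region: "expectation (time_avg x T) \<in> region"
    by (rule expectation_time_avg_in_region[OF T])
  have objective_mean: "f (expectation (time_avg x T)) \<le> f \<gamma>s + c1 * (1 / r)"
    using jensen[OF measurable_time_avg time_avg_in[OF T] subsetD[OF region_subset avg_region]] objective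
    by (rule order_trans)
  have near: "near_optimal f region A b \<gamma>s \<epsilon> (expectation (time_avg x T))"
    if \<epsilon>: "0 < \<epsilon>" and large: "real T \<ge> convergence_const K M D B L (norm lam) (norm (transpose A *v lam)) / \<epsilon>\<^sup>2" for \<epsilon>
  proof -
    define c where "c = max c1 (2 * norm lam + sqrt c2)"
    have "c\<^sup>2 / \<epsilon>\<^sup>2 \<le> real T"
      using large unfolding convergence_const_def c_def c1_def c2_def .
    then have "c\<^sup>2 \<le> real T * \<epsilon>\<^sup>2"
      by (rule pos_divide_le_eq[THEN iffD1, rotated]) (use \<epsilon> in simp)
    then have "c\<^sup>2 \<le> (r * \<epsilon>)\<^sup>2"
      unfolding power_mult_distrib r_sq .
    then have "c \<le> r * \<epsilon>"
      by (rule power2_le_imp_le) (use \<epsilon> r in simp)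
    then have c: "c / r \<le> \<epsilon>" using r by (simp add: pos_divide_le_eq mult.commute)
    have "c1 / r \<le> c / r"
      by (rule divide_right_mono) (use r in \<open>simp_all add: c_def\<close>)
    then have "f (expectation (time_avg x T)) \<le> f \<gamma>s + \<epsilon>"
      using objective_mean c by simp
    moreover have "A $ i \<bullet> expectation (time_avg x T) - b $ i \<le> \<epsilon>" for i
    proof -
      have "2 * norm lam / r + sqrt (c2 / real T) = (2 * norm lam + sqrt c2) / r"
        unfolding real_sqrt_divide r_def[symmetric] by (rule add_divide_distrib[symmetric])
      also have "\<dots> \<le> c / r"
        by (rule divide_right_mono) (use r in \<open>simp_all add: c_def\<close>)
      finally show ?thesis using violation[of i] c by linarith
    qed
    ultimately show ?thesis using avg_region by (simp add: near_optimal_def)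
  qed
  show ?thesis
    using objective violation objective_mean near unfolding c1_def c2_def r_def
    by (intro conjI allI impI) (simp_all only:)
qed

end
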